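(* Assume the model $(\xi,\vec h)$ is non-degenerate. Then $\vec h\ne\vec0$ if and only if there exists a super-solvable $\vec x\in(0,1]^{\mathscr S}$. If this holds, then for each such $\vec x$: (a) Let $q_1=\langle\vec\lambda,\vec x\rangle>0$. There is a unique root-finding trajectory $(p,\Phi)$ with endpoint $\vec x$. It is obtained by solving the system (for all $s\in\mathscr S$) $$p'(q)\,\xi^s(\Phi(q))+p(q)\sum_{s'\in\mathscr S}\partial_{x_{s'}}\xi^s(\Phi(q))\,\Phi_{s'}'(q)=L_s\Phi_s'(q),\qquad\sum_{s'\in\mathscr S}\lambda_{s'}\Phi_{s'}'(q)=1,\qquad p'(q),\Phi_s'(q)\ge0,$$ with $L_s=\frac{\xi^s(\vec x)+h_s^2}{x_s}$, backward in time from the initial condition $p(q_1)=1$, $\Phi(q_1)=\vec x$ until reaching $p(q_0)=0$. Moreover the resulting $p$ is increasing and concave on $[q_0,q_1]$. (b) $q_0>0$, and in fact $\Phi_s(q_0)>0$ if and only if $h_s>0$.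
   Context: Let $r\ge1$, $\mathscr S=\{1,\dots,r\}$, $\vec\lambda\in\mathbb R_{>0}^{\mathscr S}$ with $\sum_s\lambda_s=1$, $\vec h\in\mathbb R_{\ge0}^{\mathscr S}$. For each $k\ge2$ let $\Gamma^{(k)}=(\gamma_{s_1,\dots,s_k})\in(\mathbb R_{\ge0}^{\mathscr S})^{\otimes k}$ be a symmetric tensor, with $\sum_{k\ge2}2^k\|\Gamma^{(k)}\|_\infty<\infty$. Define $\xi(\vec x)=\sum_{k\ge2}\sum_{s_1,\dots,s_k}\gamma_{s_1,\dots,s_k}^2(\lambda_{s_1}x_{s_1})\cdots(\lambda_{s_k}x_{s_k})$ and $\xi^s(\vec x)=\lambda_s^{-1}\partial_{x_s}\xi(\vec x)$. The model is non-degenerate if all entries of $\Gamma^{(2)}$ and $\Gamma^{(3)}$ are strictly positive. For $\vec x\in(0,1]^{\mathscr S}$ let $$M^*_{\mathrm{sym}}(\vec x)=\mathrm{diag}\Big(\Big(\tfrac{\partial_{x_s}\xi(\vec x)+\lambda_sh_s^2}{x_s}\Big)_{s\in\mathscr S}\Big)-\big(\partial_{x_s}\partial_{x_{s'}}\xi(\vec x)\big)_{s,s'\in\mathscr S}.$$ The point $\vec x\in(0,1]^{\mathscr S}$ is super-solvable if $M^*_{\mathrm{sym}}(\vec x)$ is positive semidefinite. For $0\le q_0\le q_1\le1$, $\mathbb I(q_0,q_1)$ is the set of increasing (i.e. nondecreasing), continuously differentiable functions $[q_0,q_1]\to[0,1]$, and $\mathrm{Adm}(q_0,q_1)$ is the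 set of $\Phi=(\Phi_s)_s\in\mathbb I(q_0,q_1)^{\mathscr S}$ with $\langle\vec\lambda,\Phi(q)\rangle=q$ for all $q\in[q_0,q_1]$. Root-finding trajectory: let $\vec x\in(0,1]^{\mathscr S}$ be super-solvable with $\langle\vec\lambda,\vec x\rangle=q_1$. A root-finding trajectory with endpoint $\vec x$ is a pair $(p,\Phi)\in\mathbb I(q_0,q_1)\times\mathrm{Adm}(q_0,q_1)$, for some $q_0\in[0,q_1]$, such that $p(q_1)=1$, $\Phi(q_1)=\vec x$, $p(q_0)=0$, and for all $q\in[q_0,q_1]$ and $s\in\mathscr S$, $$\frac{(p\times\xi^s\circ\Phi)'(q)}{\Phi_s'(q)}=L_s:=\frac{\xi^s(\vec x)+h_s^2}{x_s},\qquad(p\times\xi^s\circ\Phi)(q)=p(q)\xi^s(\Phi(q)).$$ *)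

theory Defs
  imports "HOL-Analysis.Analysis"
begin

text \<open>
  The species set is a finite type \<open>'s\<close>. The tensors \<open>\<Gamma>^(k)\<close>, \<open>k \<ge> 2\<close>, are packed into one function on
  lists: the entry with indices \<open>s_1, ..., s_k\<close> is \<open>\<Gamma> [s_1, ..., s_k]\<close>. Values of \<open>\<Gamma>\<close> on lists
  of length 0 and 1 are irrelevant.
\<close>

definition tensor_sup_norm :: "('s::finite list \<Rightarrow> real) \<Rightarrow> nat \<Rightarrow> real" where
  "tensor_sup_norm \<Gamma> k = Max ((\<lambda>ss. \<bar>\<Gamma> ss\<bar>) ` {ss. length ss = k})"

definition model :: "real^'s \<Rightarrow> real^'s \<Rightarrow> ('s::finite list \<Rightarrow> real) \<Rightarrow> bool" where
  "model lam h \<Gamma> \<longleftrightarrow>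
     (\<forall>s. 0 < lam $ s) \<and> (\<Sum>s\<in>UNIV. lam $ s) = 1 \<and>
     (\<forall>s. 0 \<le> h $ s) \<and>
     (\<forall>ss. 2 \<le> length ss \<longrightarrow> 0 \<le> \<Gamma> ss) \<and>
     (\<forall>ss ts. 2 \<le> length ss \<and> mset ss = mset ts \<longrightarrow> \<Gamma> ss = \<Gamma> ts) \<and>
     summable (\<lambda>k. 2 ^ (k + 2) * tensor_sup_norm \<Gamma> (k + 2))"

definition nondegenerate :: "('s::finite list \<Rightarrow> real) \<Rightarrow> bool" where
  "nondegenerate \<Gamma> \<longleftrightarrow> (\<forall>ss. length ss = 2 \<or> length ss = 3 \<longrightarrow> 0 < \<Gamma> ss)"

text \<open>
  The series starts at degree 2. Under \<^const>\<open>model\<close> it converges absolutely on a neighbourhood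
  of the closed unit cube, so \<open>\<xi>\<close> is smooth there.
\<close>

definition xi :: "real^'s \<Rightarrow> ('s::finite list \<Rightarrow> real) \<Rightarrow> real^'s \<Rightarrow> real" where
  "xi lam \<Gamma> x =
     (\<Sum>k. \<Sum>ss | length ss = k + 2. (\<Gamma> ss)\<^sup>2 * (\<Prod>s\<leftarrow>ss. lam $ s * x $ s))"

definition partial_deriv :: "'s \<Rightarrow> (real^'s::finite \<Rightarrow> real) \<Rightarrow> real^'s \<Rightarrow> real" where
  "partial_deriv s f x = deriv (\<lambda>t. f (x + t *\<^sub>R axis s 1)) 0"

definition xi_species ::
    "real^'s \<Rightarrow> ('s::finite list \<Rightarrow> real) \<Rightarrow> 's \<Rightarrow> real^'s \<Rightarrow> real" where
  "xi_species lam \<Gamma> s x = partial_deriv s (xi lam \<Gamma>) x / lam $ s"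

definition positive_semidefinite :: "real^'n^'n::finite \<Rightarrow> bool" where
  "positive_semidefinite A \<longleftrightarrow> transpose A = A \<and> (\<forall>v. 0 \<le> v \<bullet> (A *v v))"

definition M_sym ::
    "real^'s \<Rightarrow> real^'s \<Rightarrow> ('s::finite list \<Rightarrow> real) \<Rightarrow> real^'s \<Rightarrow> real^'s^'s" where
  "M_sym lam h \<Gamma> x =
     (\<chi> s s'. (if s = s'
               then (partial_deriv s (xi lam \<Gamma>) x + lam $ s * (h $ s)\<^sup>2) / x $ s
               else 0)
             - partial_deriv s (partial_deriv s' (xi lam \<Gamma>)) x)"

definition half_open_cube :: "(real^'s::finite) set" where
  "half_open_cube = {x. \<forall>s. 0 < x $ s \<and> x $ s \<le> 1}"

definition super_solvable ::
    "real^'s \<Rightarrow> real^'s \<Rightarrow> ('s::finite list \<Rightarrow> real) \<Rightarrow> real^'s \<Rightarrow> bool" where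
  "super_solvable lam h \<Gamma> x \<longleftrightarrow>
     x \<in> half_open_cube \<and> positive_semidefinite (M_sym lam h \<Gamma> x)"

text \<open>
  Functions on \<open>[a, b]\<close> are represented by total functions whose values outside \<open>[a, b]\<close> are
  irrelevant, and derivatives at the endpoints are one-sided (unlike in
  \<^const>\<open>C1_differentiable_on\<close>).
\<close>

definition C1_on_interval :: "real \<Rightarrow> real \<Rightarrow> (real \<Rightarrow> real) \<Rightarrow> bool" where
  "C1_on_interval a b f \<longleftrightarrow>
     (\<exists>f'. (\<forall>q\<in>{a..b}. (f has_real_derivative f' q) (at q within {a..b})) \<and>
           continuous_on {a..b} f')"

definition incr_C1 :: "real \<Rightarrow> real \<Rightarrow> (real \<Rightarrow> real) set" where
  "incr_C1 q0 q1 =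
     {f. f ` {q0..q1} \<subseteq> {0..1} \<and> mono_on {q0..q1} f \<and> C1_on_interval q0 q1 f}"

definition Adm :: "real^'s \<Rightarrow> real \<Rightarrow> real \<Rightarrow> (real \<Rightarrow> real^'s::finite) set" where
  "Adm lam q0 q1 =
     {\<Phi>. (\<forall>s. (\<lambda>q. \<Phi> q $ s) \<in> incr_C1 q0 q1) \<and> (\<forall>q\<in>{q0..q1}. lam \<bullet> \<Phi> q = q)}"

definition L_coeff ::
    "real^'s \<Rightarrow> real^'s \<Rightarrow> ('s::finite list \<Rightarrow> real) \<Rightarrow> real^'s \<Rightarrow> 's \<Rightarrow> real" where
  "L_coeff lam h \<Gamma> x s = (xi_species lam \<Gamma> s x + (h $ s)\<^sup>2) / x $ s"

text \<open>
  The defining equation is an equation between quotients, so it includes that the denominator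
  is nonzero.
\<close>

definition root_finding_trajectory ::
    "real^'s \<Rightarrow> real^'s \<Rightarrow> ('s::finite list \<Rightarrow> real) \<Rightarrow> real^'s \<Rightarrow>
     real \<Rightarrow> (real \<Rightarrow> real) \<Rightarrow> (real \<Rightarrow> real^'s) \<Rightarrow> bool" where
  "root_finding_trajectory lam h \<Gamma> x q0 p \<Phi> \<longleftrightarrow>
     (let q1 = lam \<bullet> x in
        0 \<le> q0 \<and> q0 \<le> q1 \<and>
        p \<in> incr_C1 q0 q1 \<and> \<Phi> \<in> Adm lam q0 q1 \<and>
        p q1 = 1 \<and> \<Phi> q1 = x \<and> p q0 = 0 \<and>
        (\<forall>q\<in>{q0..q1}. \<forall>s.
           vector_derivative (\<lambda>u. \<Phi> u $ s) (at q within {q0..q1}) \<noteq> 0 \<and>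
           vector_derivative (\<lambda>u. p u * xi_species lam \<Gamma> s (\<Phi> u)) (at q within {q0..q1})
             / vector_derivative (\<lambda>u. \<Phi> u $ s) (at q within {q0..q1})
           = L_coeff lam h \<Gamma> x s))"

text \<open>
  Solution on \<open>[a, lam \<bullet> x]\<close> of the differential system with condition \<open>p = 1\<close>, \<open>\<Phi> = x\<close> at the
  right endpoint.
\<close>

definition backward_solution ::
    "real^'s \<Rightarrow> real^'s \<Rightarrow> ('s::finite list \<Rightarrow> real) \<Rightarrow> real^'s \<Rightarrow>
     real \<Rightarrow> (real \<Rightarrow> real) \<Rightarrow> (real \<Rightarrow> real^'s) \<Rightarrow> bool" where
  "backward_solution lam h \<Gamma> x a p \<Phi> \<longleftrightarrow>
     (let q1 = lam \<bullet> x in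
        a < q1 \<and> p q1 = 1 \<and> \<Phi> q1 = x \<and>
        (\<forall>q\<in>{a..q1}. \<exists>p' \<Phi>'.
           (p has_real_derivative p') (at q within {a..q1}) \<and>
           (\<Phi> has_vector_derivative \<Phi>') (at q within {a..q1}) \<and>
           (\<forall>s. p' * xi_species lam \<Gamma> s (\<Phi> q)
                  + p q * (\<Sum>s'\<in>UNIV. partial_deriv s' (xi_species lam \<Gamma> s) (\<Phi> q) * \<Phi>' $ s')
                = L_coeff lam h \<Gamma> x s * \<Phi>' $ s) \<and>
           (\<Sum>s\<in>UNIV. lam $ s * \<Phi>' $ s) = 1 \<and>
           0 \<le> p' \<and> (\<forall>s. 0 \<le> \<Phi>' $ s)))"

text \<open>
  Solving the system backward until \<open>p\<close> vanishes produces \<open>(p, \<Phi>)\<close> on \<open>[q0, q1]\<close>: it is a solution,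
  \<open>q0\<close> is the first zero of \<open>p\<close> met, and every solution that is run back to some time \<open>a\<close> without
  \<open>p\<close> becoming negative is a restriction of it.
\<close>

definition obtained_by_backward_solving ::
    "real^'s \<Rightarrow> real^'s \<Rightarrow> ('s::finite list \<Rightarrow> real) \<Rightarrow> real^'s \<Rightarrow>
     real \<Rightarrow> (real \<Rightarrow> real) \<Rightarrow> (real \<Rightarrow> real^'s) \<Rightarrow> bool" where
  "obtained_by_backward_solving lam h \<Gamma> x q0 p \<Phi> \<longleftrightarrow>
     backward_solution lam h \<Gamma> x q0 p \<Phi> \<and>
     p q0 = 0 \<and> (\<forall>q\<in>{q0<..lam \<bullet> x}. 0 < p q) \<and>
     (\<forall>a p2 \<Phi>2. backward_solution lam h \<Gamma> x a p2 \<Phi>2 \<and> (\<forall>q\<in>{a..lam \<bullet> x}. 0 \<le> p2 q)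
        \<longrightarrow> q0 \<le> a \<and> (\<forall>q\<in>{a..lam \<bullet> x}. p2 q = p q \<and> \<Phi>2 q = \<Phi> q))"

end

theory Submission
  imports Defs
begin

text \<open>
  The equation of a root-finding trajectory, \<open>(p * \<xi>^s(\<Phi>))' = L_s * \<Phi>_s'\<close>, has a first integral.
  Since \<open>L_s * x_s = \<xi>^s(x) + h_s^2\<close>, it says that \<open>L_s * \<Phi>_s = p * \<xi>^s(\<Phi>) + h_s^2\<close> along
  the whole trajectory, i.e. that \<open>\<Phi>(q)\<close> is a fixed point of the monotone map
  \<open>T_p(y)_s = (p * \<xi>^s(y) + h_s^2) / L_s\<close> with \<open>p = p(q)\<close>. All claims follow from a study of the
  fixed points of \<open>T_p\<close> in the order interval \<open>[0, x]\<close> for \<open>0 \<le> p \<le> 1\<close>.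

  Existence of a least fixed point \<open>y(p)\<close> is the Knaster-Tarski argument (\<open>least_sol_exists\<close>): the
  infimum of all supersolutions is a solution. Uniqueness (\<open>sol_unique_le\<close>) is where super-solvability
  and non-degeneracy enter: if \<open>y \<le> z\<close> are two fixed points and \<open>v = z - y\<close> is not 0, then \<open>p > 0\<close> and the
  strict monotonicity of the Hessian along the segment gives \<open>L_s * v_s < p * D\<xi>^s(z) v\<close>, and pairing
  with \<open>v\<close> contradicts the positivity of \<open>M_sym\<close> at \<open>x\<close>, which dominates the
  form at \<open>z\<close> on nonnegative vectors. In particular \<open>y(1) = x\<close>. Furthermore \<open>y(0)_s = h_s^2 / L_s\<close>,
  which yields \<open>q0 > 0\<close> and the sign pattern of \<open>\<Phi>(q0)\<close>, and if \<open>h\<close> were 0 then both 0 and \<open>x\<close> would be fixed points of \<open>T_1\<close>.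

  The map \<open>p \<mapsto> y(p)\<close> is increasing and convex, because a convex combination of two solutions is
  a supersolution for the averaged \<open>p\<close> (\<open>scaled_g_convex\<close>, \<open>branch_convex\<close>), and continuous, because
  its graph is compact. Hence \<open>p \<mapsto> \<langle>\<lambda>, y(p)\<rangle>\<close> is a convex increasing bijection onto an interval
  \<open>[q0, q1]\<close>; its inverse \<open>p(q)\<close> is concave, and \<open>\<Phi>(q) = y(p(q))\<close> is the only candidate for a
  trajectory. That \<open>(p, \<Phi>)\<close> is continuously differentiable up to both endpoints, even when \<open>M_sym\<close> is
  singular at \<open>x\<close>, follows from the inverse function theorem applied to
  \<open>(p, y) \<mapsto> (\<langle>\<lambda>, y\<rangle>, (L_s * y_s - p * \<xi>^s(y))_s)\<close>: its differential is injective along the curve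
  (\<open>linearized_injective\<close>) by a Perron-Frobenius type splitting into positive and negative parts.

  A solution of the differential system might leave the domain on which \<open>\<xi>\<close> converges. In
  \<open>backward_solution_on_curve\<close> this is excluded by following the solution backward to the last time at which
  it is still nonnegative.

  Conversely, if \<open>h\<close> is not 0, the point \<open>(\<epsilon>, ..., \<epsilon>)\<close> is super-solvable for small \<open>\<epsilon>\<close>
  by diagonal dominance with weights 1 on the species with \<open>h_s > 0\<close> and 2 on the others
  (\<open>psd_near_origin\<close>).
\<close>

section \<open>Multivariate power series indexed by words\<close>

text \<open>
  A multivariate power series is given by a coefficient for each word (list of variables); the word
  \<open>[s_1, ..., s_k]\<close> contributes the monomial \<open>y_(s_1) * ... * y_(s_k)\<close>. The series is summed by
  degree, and \<open>homog B k\<close> is its part of degree \<open>k\<close>.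
\<close>

definition homog :: "('s::finite list \<Rightarrow> real) \<Rightarrow> nat \<Rightarrow> real^'s \<Rightarrow> real" where
  "homog B k y = (\<Sum>ss | length ss = k. B ss * (\<Prod>s\<leftarrow>ss. y $ s))"

definition word_series :: "('s::finite list \<Rightarrow> real) \<Rightarrow> real^'s \<Rightarrow> real" where
  "word_series B y = (\<Sum>k. homog B k y)"

text \<open>
  For permutation-invariant coefficients the partial derivative in the variable \<open>s\<close> is the series with
  the following coefficients: each of the \<open>length ss + 1\<close> positions of \<open>s\<close> contributes the same.
\<close>

definition deriv_coeff :: "'s \<Rightarrow> ('s list \<Rightarrow> real) \<Rightarrow> 's list \<Rightarrow> real" where
  "deriv_coeff s B ss = real (Suc (length ss)) * B (s # ss)"

definition perm_invariant :: "('s list \<Rightarrow> real) \<Rightarrow> bool" where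
  "perm_invariant B \<longleftrightarrow> (\<forall>ss ts. mset ss = mset ts \<longrightarrow> B ss = B ts)"

text \<open>
  The sum of the absolute values of the coefficients of degree \<open>k\<close>.
\<close>

definition coeff_mass :: "('s::finite list \<Rightarrow> real) \<Rightarrow> nat \<Rightarrow> real" where
  "coeff_mass B k = (\<Sum>ss | length ss = k. \<bar>B ss\<bar>)"

text \<open>
  Absolute convergence with radius at least 2 in the maximum norm. The radius is the same for all derivatives
  (lemma \<open>convergent_deriv_coeff\<close>), and any radius greater than 1 would serve.
\<close>

definition convergent_coeffs :: "('s::finite list \<Rightarrow> real) \<Rightarrow> bool" where
  "convergent_coeffs B \<longleftrightarrow> (\<forall>\<rho>::real. \<bar>\<rho>\<bar> < 2 \<longrightarrow> summable (\<lambda>k. coeff_mass B k * \<rho> ^ k))"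

text \<open>
  An open neighbourhood of the closed unit cube.
\<close>

definition wide_cube :: "(real^'s::finite) set" where
  "wide_cube = {y. \<forall>s. \<bar>y $ s\<bar> < 2}"

lemma finite_words [simp]: "finite {ss :: 's::finite list. length ss = k}"
  using finite_lists_length_eq[of "UNIV :: 's set" k] by simp

lemma words_0: "{ss :: 's list. length ss = 0} = {[]}"
  by auto

lemma sum_words_Suc:
  fixes f :: "'s::finite list \<Rightarrow> real"
  shows "(\<Sum>ss | length ss = Suc k. f ss) = (\<Sum>s\<in>UNIV. \<Sum>ss | length ss = k. f (s # ss))"
proof -
  have eq: "{ss :: 's list. length ss = Suc k} = (\<lambda>(s, ss). s # ss) ` (UNIV \<times> {ss. length ss = k})"
    by (auto simp: length_Suc_conv image_iff)
  have "(\<Sum>ss | length ss = Suc k. f ss) = (\<Sum>(s, ss)\<in>UNIV \<times> {ss. length ss = k}. f (s # ss))"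
    unfolding eq by (subst sum.reindex) (auto simp: inj_on_def case_prod_beta)
  then show ?thesis
    by (simp add: sum.cartesian_product)
qed

lemma homog_0 [simp]: "homog B 0 y = B []"
  unfolding homog_def words_0 by simp

lemma homog_Suc: "homog B (Suc k) y = (\<Sum>s\<in>UNIV. y $ s * homog (\<lambda>ss. B (s # ss)) k y)"
  unfolding homog_def sum_words_Suc by (simp add: sum_distrib_left mult_ac)

lemma homog_deriv_coeff: "homog (deriv_coeff s B) k y = real (Suc k) * homog (\<lambda>ss. B (s # ss)) k y"
  unfolding homog_def deriv_coeff_def sum_distrib_left by (rule sum.cong) auto

lemma perm_invariant_Cons: "perm_invariant B \<Longrightarrow> perm_invariant (\<lambda>ss. B (s # ss))"
  unfolding perm_invariant_def by auto

lemma perm_invariant_deriv_coeff: "perm_invariant B \<Longrightarrow> perm_invariant (deriv_coeff s B)"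
  unfolding perm_invariant_def deriv_coeff_def
  by (metis mset_eq_length perm_invariant_Cons perm_invariant_def)

lemma deriv_coeff_commute:
  "perm_invariant B \<Longrightarrow> deriv_coeff s (deriv_coeff t B) = deriv_coeff t (deriv_coeff s B)"
  by (rule ext) (auto simp: deriv_coeff_def perm_invariant_def add_mset_commute)

lemma has_derivative_homog:
  assumes "perm_invariant B"
  shows "(homog B k has_derivative
          (\<lambda>v. \<Sum>s\<in>UNIV. v $ s * (real k * homog (\<lambda>ss. B (s # ss)) (k - 1) y))) (at y)"
  using assms
proof (induction k arbitrary: B)
  case 0
  have "homog B 0 = (\<lambda>_. B [])" by auto
  then show ?case by simp
next
  case (Suc k)
  have IH: "(homog (\<lambda>ss. B (s # ss)) k has_derivative
      (\<lambda>v. \<Sum>t\<in>UNIV. v $ t * (real k * homog (\<lambda>ss. B (s # t # ss)) (k - 1) y))) (at y)" for s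
    using Suc.IH[OF perm_invariant_Cons[OF Suc.prems]] .
  have proj: "((\<lambda>y. y $ s) has_derivative (\<lambda>v. v $ s)) (at y)" for s :: 'a
    by (rule bounded_linear_imp_has_derivative) (rule bounded_linear_vec_nth)
  have "(homog B (Suc k) has_derivative
      (\<lambda>v. \<Sum>s\<in>UNIV. y $ s * (\<Sum>t\<in>UNIV. v $ t * (real k * homog (\<lambda>ss. B (s # t # ss)) (k - 1) y))
         + v $ s * homog (\<lambda>ss. B (s # ss)) k y)) (at y)"
    unfolding homog_Suc by (intro has_derivative_sum has_derivative_mult proj IH)
  also have "(\<lambda>v. \<Sum>s\<in>UNIV. y $ s * (\<Sum>t\<in>UNIV. v $ t * (real k * homog (\<lambda>ss. B (s # t # ss)) (k - 1) y))
         + v $ s * homog (\<lambda>ss. B (s # ss)) k y)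
      = (\<lambda>v. \<Sum>s\<in>UNIV. v $ s * (real (Suc k) * homog (\<lambda>ss. B (s # ss)) (Suc k - 1) y))"
  proof
    fix v :: "real^'a"
    \<comment> \<open>permutation invariance moves the differentiated variable to the front\<close>
    have swap: "(\<Sum>s\<in>UNIV. y $ s * (real k * homog (\<lambda>ss. B (s # t # ss)) (k - 1) y))
        = real k * homog (\<lambda>ss. B (t # ss)) k y" for t
    proof (cases k)
      case (Suc j)
      have "B (s # t # ss) = B (t # s # ss)" for s ss
        using Suc.prems unfolding perm_invariant_def by (simp add: add_mset_commute)
      then have "(\<Sum>s\<in>UNIV. y $ s * homog (\<lambda>ss. B (s # t # ss)) j y) = homog (\<lambda>ss. B (t # ss)) (Suc j) y"
        unfolding homog_Suc by simp
      moreover have "(\<Sum>s\<in>UNIV. y $ s * (real k * homog (\<lambda>ss. B (s # t # ss)) j y))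
          = real k * (\<Sum>s\<in>UNIV. y $ s * homog (\<lambda>ss. B (s # t # ss)) j y)"
        by (simp add: sum_distrib_left mult.left_commute)
      ultimately show ?thesis
        using Suc by simp
    qed simp
    have "(\<Sum>s\<in>UNIV. y $ s * (\<Sum>t\<in>UNIV. v $ t * (real k * homog (\<lambda>ss. B (s # t # ss)) (k - 1) y)))
      = (\<Sum>s\<in>UNIV. \<Sum>t\<in>UNIV. v $ t * (y $ s * (real k * homog (\<lambda>ss. B (s # t # ss)) (k - 1) y)))"
      by (simp add: sum_distrib_left mult_ac)
    also have "\<dots> = (\<Sum>t\<in>UNIV. v $ t * (real k * homog (\<lambda>ss. B (t # ss)) k y))"
      by (subst sum.swap) (simp only: swap flip: sum_distrib_left)
    finally show "(\<Sum>s\<in>UNIV. y $ s * (\<Sum>t\<in>UNIV. v $ t * (real k * homog (\<lambda>ss. B (s # t # ss)) (k - 1) y))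
         + v $ s * homog (\<lambda>ss. B (s # ss)) k y)
      = (\<Sum>s\<in>UNIV. v $ s * (real (Suc k) * homog (\<lambda>ss. B (s # ss)) (Suc k - 1) y))"
      by (simp add: sum.distrib algebra_simps)
  qed
  finally show ?case .
qed

lemma abs_homog_le:
  assumes "\<And>s. \<bar>y $ s\<bar> \<le> \<rho>"
  shows "\<bar>homog B k y\<bar> \<le> coeff_mass B k * \<rho> ^ k"
proof (induction k arbitrary: B)
  case 0
  show ?case unfolding coeff_mass_def words_0 by simp
next
  case (Suc k)
  have "\<bar>homog B (Suc k) y\<bar> \<le> (\<Sum>s\<in>UNIV. \<bar>y $ s\<bar> * \<bar>homog (\<lambda>ss. B (s # ss)) k y\<bar>)"
    unfolding homog_Suc by (rule order_trans[OF sum_abs]) (simp add: abs_mult)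
  also have "\<dots> \<le> (\<Sum>s\<in>UNIV. \<rho> * (coeff_mass (\<lambda>ss. B (s # ss)) k * \<rho> ^ k))"
    by (intro sum_mono mult_mono assms Suc.IH order_trans[OF abs_ge_zero assms[of undefined]]) auto
  also have "\<dots> = coeff_mass B (Suc k) * \<rho> ^ Suc k"
    unfolding coeff_mass_def sum_words_Suc sum_distrib_right sum_distrib_left by (simp add: mult_ac)
  finally show ?case .
qed

lemma coeff_mass_nonneg: "0 \<le> coeff_mass B k"
  unfolding coeff_mass_def by (simp add: sum_nonneg)

lemma convergent_deriv_coeff:
  assumes "convergent_coeffs B"
  shows "convergent_coeffs (deriv_coeff s B)"
  unfolding convergent_coeffs_def
proof (intro allI impI)
  fix \<rho> :: real
  assume \<rho>: "\<bar>\<rho>\<bar> < 2"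
  have "summable (\<lambda>k. diffs (coeff_mass B) k * \<bar>\<rho>\<bar> ^ k)"
    by (rule termdiff_converges[where K = 2]) (use \<rho> assms in \<open>auto simp: convergent_coeffs_def\<close>)
  then show "summable (\<lambda>k. coeff_mass (deriv_coeff s B) k * \<rho> ^ k)"
  proof (rule summable_comparison_test')
    fix k :: nat
    have "coeff_mass (deriv_coeff s B) k = real (Suc k) * (\<Sum>ss | length ss = k. \<bar>B (s # ss)\<bar>)"
      unfolding coeff_mass_def deriv_coeff_def sum_distrib_left
      by (rule sum.cong) (auto simp: abs_mult)
    also have "\<dots> \<le> real (Suc k) * coeff_mass B (Suc k)"
      unfolding coeff_mass_def sum_words_Suc
      by (intro mult_left_mono member_le_sum) (auto intro: sum_nonneg)
    finally have "coeff_mass (deriv_coeff s B) k \<le> diffs (coeff_mass B) k"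
      by (simp add: diffs_def)
    then show "norm (coeff_mass (deriv_coeff s B) k * \<rho> ^ k) \<le> diffs (coeff_mass B) k * \<bar>\<rho>\<bar> ^ k"
      by (simp add: abs_mult power_abs coeff_mass_nonneg mult_right_mono)
  qed
qed

lemma wide_cube_radius:
  assumes "y \<in> wide_cube"
  obtains \<rho> where "0 < \<rho>" "\<rho> < 2" "\<And>s. \<bar>y $ s\<bar> < \<rho>"
proof -
  define m where "m = Max (range (\<lambda>s. \<bar>y $ s\<bar>))"
  have "m < 2" unfolding m_def using assms by (subst Max_less_iff) (auto simp: wide_cube_def)
  have le: "\<bar>y $ s\<bar> \<le> m" for s unfolding m_def by (rule Max_ge) auto
  have "0 \<le> m" using le[of undefined] by linarith
  show thesis
  proof
    show "0 < (m + 2) / 2" "(m + 2) / 2 < 2" using \<open>0 \<le> m\<close> \<open>m < 2\<close> by simp_all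
    show "\<bar>y $ s\<bar> < (m + 2) / 2" for s using le[of s] \<open>m < 2\<close> by simp
  qed
qed

lemma summable_homog:
  assumes "convergent_coeffs B" "y \<in> wide_cube"
  shows "summable (\<lambda>k. homog B k y)"
proof -
  obtain \<rho> where \<rho>: "0 < \<rho>" "\<rho> < 2" "\<And>s. \<bar>y $ s\<bar> < \<rho>"
    using wide_cube_radius[OF assms(2)] by blast
  show ?thesis
  proof (rule summable_comparison_test')
    show "summable (\<lambda>k. coeff_mass B k * \<rho> ^ k)"
      using assms(1) \<rho> by (auto simp: convergent_coeffs_def)
    show "norm (homog B k y) \<le> coeff_mass B k * \<rho> ^ k" for k
      using abs_homog_le[of y \<rho> B k] \<rho>(3) by (auto simp: less_imp_le)
  qed
qed

lemma open_wide_cube: "open (wide_cube :: (real^'s::finite) set)"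
proof -
  have "wide_cube = (\<Inter>s\<in>UNIV. {y::real^'s. \<bar>y $ s\<bar> < 2})"
    by (auto simp: wide_cube_def)
  also have "open \<dots>"
    by (intro open_INT ballI open_Collect_less continuous_intros) auto
  finally show ?thesis .
qed

lemma has_derivative_word_series:
  fixes B :: "'s::finite list \<Rightarrow> real"
  assumes B: "perm_invariant B" "convergent_coeffs B" and y: "y \<in> wide_cube"
  shows "(word_series B has_derivative (\<lambda>v. \<Sum>s\<in>UNIV. v $ s * word_series (deriv_coeff s B) y)) (at y)"
proof -
  obtain \<rho> where \<rho>: "0 < \<rho>" "\<rho> < 2" "\<And>s. \<bar>y $ s\<bar> < \<rho>"
    using wide_cube_radius[OF y] by blast
  define S where "S = {z :: real^'s. \<forall>s. \<bar>z $ s\<bar> < \<rho>}"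
  have S_eq: "S = (\<Inter>s\<in>UNIV. {z. \<bar>z $ s\<bar> < \<rho>})" by (auto simp: S_def)
  have openS: "open S"
    unfolding S_eq by (intro open_INT ballI open_Collect_less continuous_intros) auto
  have convexS: "convex S"
  proof -
    have "{z :: real^'s. \<bar>z $ s\<bar> < \<rho>} = {z. inner (axis s 1) z < \<rho>} \<inter> {z. inner (axis s 1) z > -\<rho>}" for s
      by (auto simp: inner_axis')
    then show ?thesis
      unfolding S_eq by (auto intro!: convex_INT convex_Int convex_halfspace_lt convex_halfspace_gt)
  qed
  have S_wide: "z \<in> wide_cube" if "z \<in> S" for z
    unfolding wide_cube_def
  proof (intro CollectI allI)
    fix s
    show "\<bar>z $ s\<bar> < 2" using that \<rho>(2) unfolding S_def by (auto intro: less_trans)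
  qed
  define d where "d s k z = real k * homog (\<lambda>ss. B (s # ss)) (k - 1) z" for s k and z :: "real^'s"
  have d_Suc: "d s (Suc k) z = homog (deriv_coeff s B) k z" for s k z
    by (simp add: d_def homog_deriv_coeff)
  have d_sums: "(\<lambda>k. d s k z) sums word_series (deriv_coeff s B) z" if "z \<in> S" for s z
  proof -
    have "(\<lambda>k. d s (Suc k) z) sums word_series (deriv_coeff s B) z"
      unfolding d_Suc word_series_def
      by (intro summable_sums summable_homog convergent_deriv_coeff B S_wide that)
    then show ?thesis
      by (subst (asm) sums_Suc_iff) (simp add: d_def)
  qed
  have unif: "uniform_limit S (\<lambda>n z. \<Sum>k<n. d s k z) (\<lambda>z. word_series (deriv_coeff s B) z) sequentially" for s
  proof -
    define M where "M k = (case k of 0 \<Rightarrow> 0 | Suc j \<Rightarrow> coeff_mass (deriv_coeff s B) j * \<rho> ^ j)" for k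
    have "summable M"
      using convergent_deriv_coeff[OF B(2), of s] \<rho>(1,2)
      by (subst summable_Suc_iff[symmetric]) (simp add: M_def convergent_coeffs_def)
    moreover have "norm (d s k z) \<le> M k" if "z \<in> S" for k z
    proof (cases k)
      case (Suc j)
      then show ?thesis
        using abs_homog_le[of z \<rho> "deriv_coeff s B" j] that
        by (simp add: d_Suc M_def S_def less_imp_le)
    qed (simp add: M_def d_def)
    ultimately have "uniform_limit S (\<lambda>n z. \<Sum>k<n. d s k z) (\<lambda>z. \<Sum>k. d s k z) sequentially"
      by (intro Weierstrass_m_test)
    then show ?thesis
      by (rule uniform_limit_cong'[THEN iffD1, rotated -1]) (use d_sums in \<open>auto simp: sums_iff\<close>)
  qed
  have "\<exists>g. \<forall>z\<in>S. (\<lambda>k. homog B k z) sums g z \<and>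
      (g has_derivative (\<lambda>v. \<Sum>s\<in>UNIV. v $ s * word_series (deriv_coeff s B) z)) (at z within S)"
  proof (rule has_derivative_series[OF convexS])
    show "(homog B k has_derivative (\<lambda>v. \<Sum>s\<in>UNIV. v $ s * d s k z)) (at z within S)" for k z
      unfolding d_def by (rule has_derivative_at_withinI[OF has_derivative_homog[OF B(1)]])
    show "y \<in> S" using \<rho> by (simp add: S_def)
    show "(\<lambda>k. homog B k y) sums word_series B y"
      unfolding word_series_def by (intro summable_sums summable_homog B y)
    fix e :: real
    assume e: "e > 0"
    define N where "N = real CARD('s)"
    have N: "N > 0" unfolding N_def by simp
    have "\<forall>\<^sub>F n in sequentially. \<forall>s\<in>UNIV. \<forall>z\<in>S. dist (\<Sum>k<n. d s k z) (word_series (deriv_coeff s B) z) < e / N"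
      by (intro eventually_ball_finite ballI uniform_limitD[OF unif]) (use e N in auto)
    then show "\<forall>\<^sub>F n in sequentially. \<forall>z\<in>S. \<forall>h. norm ((\<Sum>k<n. \<Sum>s\<in>UNIV. h $ s * d s k z)
        - (\<Sum>s\<in>UNIV. h $ s * word_series (deriv_coeff s B) z)) \<le> e * norm h"
    proof (eventually_elim, intro ballI allI)
      fix n z and h :: "real^'s"
      assume ev: "\<forall>s\<in>UNIV. \<forall>z\<in>S. dist (\<Sum>k<n. d s k z) (word_series (deriv_coeff s B) z) < e / N" and z: "z \<in> S"
      have "(\<Sum>k<n. \<Sum>s\<in>UNIV. h $ s * d s k z) - (\<Sum>s\<in>UNIV. h $ s * word_series (deriv_coeff s B) z)
          = (\<Sum>s\<in>UNIV. h $ s * ((\<Sum>k<n. d s k z) - word_series (deriv_coeff s B) z))"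
        by (subst sum.swap) (simp add: sum_distrib_left right_diff_distrib sum_subtractf)
      also have "norm \<dots> \<le> (\<Sum>s\<in>(UNIV::'s set). norm h * (e / N))"
        unfolding real_norm_def
      proof (rule order_trans[OF sum_abs], rule sum_mono)
        fix s :: 's
        have "\<bar>h $ s\<bar> * \<bar>(\<Sum>k<n. d s k z) - word_series (deriv_coeff s B) z\<bar> \<le> norm h * (e / N)"
          using ev z by (intro mult_mono component_le_norm_cart) (auto simp: dist_real_def intro: less_imp_le)
        then show "\<bar>h $ s * ((\<Sum>k<n. d s k z) - word_series (deriv_coeff s B) z)\<bar> \<le> norm h * (e / N)"
          by (simp add: abs_mult)
      qed
      also have "\<dots> = e * norm h" using N by (simp add: N_def)
      finally show "norm ((\<Sum>k<n. \<Sum>s\<in>UNIV. h $ s * d s k z)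
        - (\<Sum>s\<in>UNIV. h $ s * word_series (deriv_coeff s B) z)) \<le> e * norm h" .
    qed
  qed
  then obtain g where g: "\<And>z. z \<in> S \<Longrightarrow> (\<lambda>k. homog B k z) sums g z"
    "\<And>z. z \<in> S \<Longrightarrow> (g has_derivative (\<lambda>v. \<Sum>s\<in>UNIV. v $ s * word_series (deriv_coeff s B) z)) (at z within S)"
    by blast
  have yS: "y \<in> S" using \<rho> by (simp add: S_def)
  have "(g has_derivative (\<lambda>v. \<Sum>s\<in>UNIV. v $ s * word_series (deriv_coeff s B) y)) (at y)"
    using g(2)[OF yS] at_within_open[OF yS openS] by simp
  then show ?thesis
    by (rule has_derivative_transform_within_open[OF _ openS yS])
      (use g(1) in \<open>auto simp: word_series_def sums_iff\<close>)
qed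

lemma continuous_on_word_series:
  assumes "perm_invariant B" "convergent_coeffs B"
  shows "continuous_on wide_cube (word_series B)"
  by (intro continuous_at_imp_continuous_on ballI has_derivative_continuous[OF has_derivative_word_series] assms)

lemma homog_mono:
  assumes "\<And>ss. 0 \<le> B ss" "\<And>s. 0 \<le> y $ s" "\<And>s. y $ s \<le> z $ s"
  shows "homog B k y \<le> homog B k z"
proof -
  have "0 \<le> (\<Prod>s\<leftarrow>ss. y $ s) \<and> (\<Prod>s\<leftarrow>ss. y $ s) \<le> (\<Prod>s\<leftarrow>ss. z $ s)" for ss
  proof (induction ss)
    case (Cons s ss)
    have "0 \<le> z $ s" using assms(2,3) by (rule order_trans)
    then show ?case
      using Cons assms(2,3)[of s] by (auto intro!: mult_mono mult_nonneg_nonneg)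
  qed simp
  then show ?thesis
    unfolding homog_def by (intro sum_mono mult_left_mono assms) auto
qed

lemma word_series_strict_mono:
  assumes "convergent_coeffs B" "\<And>ss. 0 \<le> B ss" "\<And>s. 0 < B [s]"
    "\<And>s. 0 \<le> y $ s" "\<And>s. y $ s \<le> z $ s" "y \<noteq> z"
    "y \<in> wide_cube" "z \<in> wide_cube"
  shows "word_series B y < word_series B z"
proof -
  have sm: "summable (\<lambda>k. homog B k y)" "summable (\<lambda>k. homog B k z)"
    using assms by (auto intro: summable_homog)
  obtain s where s: "y $ s \<noteq> z $ s" using assms(6) by (auto simp: vec_eq_iff)
  have "homog B 1 y < homog B 1 z"
    unfolding One_nat_def homog_Suc homog_0
  proof (rule sum_strict_mono_ex1)
    show "\<forall>t\<in>UNIV. y $ t * B [t] \<le> z $ t * B [t]"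
      using assms(3,5) by (auto intro!: mult_right_mono less_imp_le)
    show "\<exists>t\<in>UNIV. y $ t * B [t] < z $ t * B [t]"
      using s assms(3)[of s] assms(5)[of s] by (intro bexI[of _ s] mult_strict_right_mono) auto
  qed auto
  then have "0 < (\<Sum>k. homog B k z - homog B k y)"
    by (intro suminf_pos2[where i = 1] summable_diff sm) (auto intro!: homog_mono assms)
  then show ?thesis
    unfolding word_series_def using suminf_diff[OF sm(2,1)] by simp
qed

lemma word_series_pos:
  assumes "convergent_coeffs B" "\<And>ss. 0 \<le> B ss" "0 < B []" "\<And>s. 0 \<le> y $ s" "y \<in> wide_cube"
  shows "0 < word_series B y"
proof -
  have "0 \<le> (\<Prod>s\<leftarrow>ss. y $ s)" for ss by (induction ss) (auto simp: assms(4))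
  then have "0 \<le> homog B k y" for k
    unfolding homog_def by (intro sum_nonneg mult_nonneg_nonneg assms)
  then show ?thesis
    unfolding word_series_def using assms
    by (intro suminf_pos2[where i = 0] summable_homog) auto
qed

lemma word_series_zero: "word_series B 0 = B []"
proof -
  have "homog B k 0 = 0" if "k \<noteq> 0" for k
    using that by (cases k) (auto simp: homog_Suc)
  then have "(\<lambda>k. homog B k 0) sums homog B 0 0"
    using sums_finite[of "{0}" "\<lambda>k. homog B k 0"] by auto
  then show ?thesis unfolding word_series_def by (simp add: sums_iff)
qed

section \<open>Calculus on closed intervals\<close>

lemma has_derivative_vecI:
  fixes f :: "'a::real_normed_vector \<Rightarrow> real^'s::finite"
  assumes "\<And>s. ((\<lambda>y. f y $ s) has_derivative (\<lambda>v. f' v $ s)) (at y within S)"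
  shows "(f has_derivative f') (at y within S)"
proof (rule has_derivative_componentwise_within[THEN iffD2], rule ballI)
  fix i :: "real^'s"
  assume "i \<in> Basis"
  then obtain s where "i = axis s 1" by (auto simp: Basis_vec_def)
  then show "((\<lambda>y. f y \<bullet> i) has_derivative (\<lambda>v. f' v \<bullet> i)) (at y within S)"
    using assms[of s] by (simp add: inner_axis)
qed

text \<open>
  A continuous curve that a map with injective differential sends to a straight line is continuously
  differentiable, with one-sided derivatives at the endpoints. The map need not be invertible near the
  curve; only its differential at the points of the curve is used.
\<close>

lemma C1_curve_of_linear_image:
  fixes c :: "real \<Rightarrow> 'a::euclidean_space" and G :: "'a \<Rightarrow> 'a" and DG :: "real \<Rightarrow> 'a \<Rightarrow> 'a"
  assumes c: "continuous_on {\<alpha>..\<beta>} c"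
    and G: "\<And>q. q \<in> {\<alpha>..\<beta>} \<Longrightarrow> (G has_derivative DG q) (at (c q))"
    and DG: "\<And>w. continuous_on {\<alpha>..\<beta>} (\<lambda>q. DG q w)"
    and inj: "\<And>q w. q \<in> {\<alpha>..\<beta>} \<Longrightarrow> DG q w = 0 \<Longrightarrow> w = 0"
    and Gc: "\<And>q. q \<in> {\<alpha>..\<beta>} \<Longrightarrow> G (c q) = z + q *\<^sub>R e"
  obtains c' where "continuous_on {\<alpha>..\<beta>} c'"
    "\<And>q. q \<in> {\<alpha>..\<beta>} \<Longrightarrow> (c has_vector_derivative c' q) (at q within {\<alpha>..\<beta>})"
    "\<And>q. q \<in> {\<alpha>..\<beta>} \<Longrightarrow> DG q (c' q) = e"
proof
  define c' where "c' q = (SOME w. DG q w = e)" for q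
  have lin: "linear (DG q)" if "q \<in> {\<alpha>..\<beta>}" for q
    using has_derivative_linear[OF G[OF that]] .
  have inj': "inj (DG q)" if "q \<in> {\<alpha>..\<beta>}" for q
    using linear_injective_0[OF lin[OF that]] inj[OF that] by blast
  show DG_c': "DG q (c' q) = e" if "q \<in> {\<alpha>..\<beta>}" for q
  proof -
    have "surj (DG q)" using linear_injective_imp_surjective[OF lin inj'] that by blast
    then have "\<exists>w. DG q w = e" by (metis surjD)
    then show ?thesis unfolding c'_def by (rule someI_ex)
  qed
  show "(c has_vector_derivative c' q0) (at q0 within {\<alpha>..\<beta>})" if q0: "q0 \<in> {\<alpha>..\<beta>}" for q0
    unfolding has_vector_derivative_def has_derivative_within_alt
  proof (intro conjI allI impI)
    show "bounded_linear (\<lambda>h. h *\<^sub>R c' q0)" by (rule bounded_linear_scaleR_left)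
    fix \<epsilon> :: real
    assume \<epsilon>: "\<epsilon> > 0"
    obtain m where m: "m > 0" "\<And>w. m * norm w \<le> norm (DG q0 w)"
      using linear_inj_bounded_below_pos[OF lin[OF q0] inj'[OF q0]] by metis
    \<comment> \<open>a Lipschitz constant of \<open>c\<close> at \<open>q0\<close>, obtained below once \<open>\<delta> \<le> m / 2\<close>\<close>
    define K where "K = 2 * (norm e + 1) / m"
    have K: "K > 0" unfolding K_def using m(1) by (intro divide_pos_pos) (auto intro: add_nonneg_pos)
    define \<delta> where "\<delta> = min (m / 2) (\<epsilon> * m / K)"
    have \<delta>: "\<delta> > 0" "\<delta> \<le> m / 2" "\<delta> * K \<le> \<epsilon> * m"
      using m(1) \<epsilon> K by (auto simp: \<delta>_def min_def field_simps)
    obtain d1 where d1: "d1 > 0" "\<And>y. norm (y - c q0) < d1 \<Longrightarrow>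
        norm (G y - G (c q0) - DG q0 (y - c q0)) \<le> \<delta> * norm (y - c q0)"
      using G[OF q0] \<delta>(1) unfolding has_derivative_at_alt by metis
    obtain d where d: "d > 0" "\<And>q. q \<in> {\<alpha>..\<beta>} \<Longrightarrow> norm (q - q0) < d \<Longrightarrow> norm (c q - c q0) < d1"
      using c q0 d1(1) unfolding continuous_on_iff dist_norm by metis
    show "\<exists>d>0. \<forall>q\<in>{\<alpha>..\<beta>}. norm (q - q0) < d \<longrightarrow>
        norm (c q - c q0 - (q - q0) *\<^sub>R c' q0) \<le> \<epsilon> * norm (q - q0)"
    proof (intro exI[of _ d] conjI ballI impI d(1))
      fix q assume q: "q \<in> {\<alpha>..\<beta>}" "norm (q - q0) < d"
      define D where "D = c q - c q0"
      have "norm (G (c q) - G (c q0) - DG q0 D) \<le> \<delta> * norm D"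
        unfolding D_def by (rule d1(2)[OF d(2)[OF q]])
      then have le: "norm ((q - q0) *\<^sub>R e - DG q0 D) \<le> \<delta> * norm D"
        unfolding Gc[OF q(1)] Gc[OF q0] by (simp add: scaleR_left_diff_distrib)
      have "m * norm D \<le> norm (DG q0 D)" by (rule m(2))
      also have "\<dots> \<le> norm ((q - q0) *\<^sub>R e) + norm ((q - q0) *\<^sub>R e - DG q0 D)"
        by (metis norm_minus_commute norm_triangle_sub)
      also have "\<dots> \<le> \<bar>q - q0\<bar> * norm e + m / 2 * norm D"
        using le \<delta>(2) mult_right_mono[OF \<delta>(2) norm_ge_zero[of D]] by simp
      finally have "m * norm D \<le> \<bar>q - q0\<bar> * (2 * norm e)" by simp
      also have "\<dots> \<le> \<bar>q - q0\<bar> * (2 * (norm e + 1))" by (intro mult_left_mono) auto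
      finally have Dle: "norm D \<le> K * \<bar>q - q0\<bar>"
        unfolding K_def using m(1) by (simp add: field_simps)
      have "m * norm (D - (q - q0) *\<^sub>R c' q0) \<le> norm (DG q0 (D - (q - q0) *\<^sub>R c' q0))" by (rule m(2))
      also have "DG q0 (D - (q - q0) *\<^sub>R c' q0) = - ((q - q0) *\<^sub>R e - DG q0 D)"
        using DG_c'[OF q0] lin[OF q0] by (simp add: linear_diff linear_scale)
      also have "norm \<dots> \<le> \<delta> * norm D" using le by (simp only: norm_minus_cancel)
      also have "\<dots> \<le> \<delta> * (K * \<bar>q - q0\<bar>)" using Dle \<delta>(1) by (intro mult_left_mono) auto
      also have "\<dots> \<le> m * (\<epsilon> * \<bar>q - q0\<bar>)"
        using mult_right_mono[OF \<delta>(3) abs_ge_zero[of "q - q0"]] by (simp add: mult_ac)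
      finally show "norm (c q - c q0 - (q - q0) *\<^sub>R c' q0) \<le> \<epsilon> * norm (q - q0)"
        using m(1) by (simp add: D_def)
    qed
  qed
  show "continuous_on {\<alpha>..\<beta>} c'"
    unfolding continuous_on_def
  proof
    fix q0 assume q0: "q0 \<in> {\<alpha>..\<beta>}"
    obtain m where m: "m > 0" "\<And>w. m * norm w \<le> norm (DG q0 w)"
      using linear_inj_bounded_below_pos[OF lin[OF q0] inj'[OF q0]] by metis
    \<comment> \<open>bounds the operator norm of \<open>DG q - DG q0\<close>\<close>
    define N where "N q = (\<Sum>i\<in>Basis. norm (DG q i - DG q0 i))" for q
    have "continuous_on {\<alpha>..\<beta>} N" unfolding N_def by (intro continuous_intros DG)
    then have "(N \<longlongrightarrow> N q0) (at q0 within {\<alpha>..\<beta>})" using q0 by (simp add: continuous_on_def)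
    then have N: "(N \<longlongrightarrow> 0) (at q0 within {\<alpha>..\<beta>})" by (simp add: N_def)
    have opnorm: "norm (DG q w - DG q0 w) \<le> N q * norm w" if "q \<in> {\<alpha>..\<beta>}" for q w
    proof -
      have ex: "DG r w = (\<Sum>i\<in>Basis. inner w i *\<^sub>R DG r i)" if "r \<in> {\<alpha>..\<beta>}" for r
      proof -
        have "DG r w = DG r (\<Sum>i\<in>Basis. inner w i *\<^sub>R i)" by (simp only: euclidean_representation)
        then show ?thesis using lin[OF that] by (simp add: linear_sum linear_scale)
      qed
      have "norm (DG q w - DG q0 w) = norm (\<Sum>i\<in>Basis. inner w i *\<^sub>R (DG q i - DG q0 i))"
        unfolding ex[OF that] ex[OF q0] by (simp add: sum_subtractf scaleR_diff_right)
      also have "\<dots> \<le> (\<Sum>i\<in>Basis. norm (DG q i - DG q0 i) * norm w)"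
        by (rule sum_norm_le) (auto simp: mult.commute intro!: mult_right_mono Basis_le_norm)
      finally show ?thesis by (simp add: N_def sum_distrib_right)
    qed
    have key: "m * norm (c' q - c' q0) \<le> N q * norm (c' q)" if q: "q \<in> {\<alpha>..\<beta>}" for q
    proof -
      have "m * norm (c' q - c' q0) \<le> norm (DG q0 (c' q - c' q0))" by (rule m(2))
      also have "DG q0 (c' q - c' q0) = - (DG q (c' q) - DG q0 (c' q))"
        using lin[OF q0] DG_c'[OF q] DG_c'[OF q0] by (simp add: linear_diff)
      also have "norm \<dots> \<le> N q * norm (c' q)" using opnorm[OF q] by (simp only: norm_minus_cancel)
      finally show ?thesis .
    qed
    have "\<forall>\<^sub>F q in at q0 within {\<alpha>..\<beta>}. N q < m / 2"
      using N m(1) by (intro order_tendstoD) auto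
    moreover have "\<forall>\<^sub>F q in at q0 within {\<alpha>..\<beta>}. q \<in> {\<alpha>..\<beta>}"
      by (simp add: eventually_at_filter)
    ultimately have "\<forall>\<^sub>F q in at q0 within {\<alpha>..\<beta>}. norm (c' q - c' q0) \<le> N q * (2 * norm (c' q0) / m)"
    proof eventually_elim
      case (elim q)
      have "0 \<le> N q" unfolding N_def by (intro sum_nonneg) auto
      have "m * norm (c' q - c' q0) \<le> N q * norm (c' q)" by (rule key[OF elim(2)])
      also have "\<dots> \<le> N q * (norm (c' q0) + norm (c' q - c' q0))"
        using \<open>0 \<le> N q\<close> by (intro mult_left_mono norm_triangle_sub)
      also have "\<dots> \<le> N q * norm (c' q0) + m / 2 * norm (c' q - c' q0)"
        using elim(1) mult_right_mono[of "N q" "m / 2" "norm (c' q - c' q0)"] by (simp add: algebra_simps)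
      finally show ?case using m(1) by (simp add: field_simps)
    qed
    moreover have "((\<lambda>q. N q * (2 * norm (c' q0) / m)) \<longlongrightarrow> 0) (at q0 within {\<alpha>..\<beta>})"
      using tendsto_mult_left_zero[OF N] .
    ultimately have "((\<lambda>q. c' q - c' q0) \<longlongrightarrow> 0) (at q0 within {\<alpha>..\<beta>})"
      by (rule Lim_null_comparison)
    then show "(c' \<longlongrightarrow> c' q0) (at q0 within {\<alpha>..\<beta>})"
      using Lim_null by blast
  qed
qed

lemma mono_on_deriv_within_nonneg:
  fixes f :: "real \<Rightarrow> real"
  assumes "mono_on {\<alpha>..\<beta>} f" "(f has_real_derivative D) (at q within {\<alpha>..\<beta>})" "q \<in> {\<alpha>..\<beta>}" "\<alpha> < \<beta>"
  shows "0 \<le> D"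
proof (rule tendsto_lowerbound)
  show "((\<lambda>r. (f r - f q) / (r - q)) \<longlongrightarrow> D) (at q within {\<alpha>..\<beta>})"
    using assms(2) by (simp add: has_field_derivative_iff)
  have "0 \<le> (f r - f q) / (r - q)" if "r \<in> {\<alpha>..\<beta>}" for r
    using mono_onD[OF assms(1), of r q] mono_onD[OF assms(1), of q r] that assms(3)
    by (cases "r \<le> q") (auto simp: zero_le_divide_iff)
  then show "\<forall>\<^sub>F r in at q within {\<alpha>..\<beta>}. 0 \<le> (f r - f q) / (r - q)"
    by (simp add: eventually_at_filter)
  have "\<alpha> \<in> {\<alpha>..\<beta>}" "\<beta> \<in> {\<alpha>..\<beta>}" using assms(4) by auto
  then have "{\<alpha>..\<beta>} \<noteq> {q}" using assms(4) by (metis less_irrefl singletonD)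
  then have "q islimpt {\<alpha>..\<beta>}" using assms(3) by (intro connected_imp_perfect) auto
  then show "at q within {\<alpha>..\<beta>} \<noteq> bot" by (simp add: trivial_limit_within)
qed

lemma deriv_within_nonneg_imp_mono_on:
  fixes f :: "real \<Rightarrow> real"
  assumes D: "\<And>q. q \<in> {\<alpha>..\<beta>} \<Longrightarrow> (f has_real_derivative D q) (at q within {\<alpha>..\<beta>})"
    and nonneg: "\<And>q. q \<in> {\<alpha>..\<beta>} \<Longrightarrow> 0 \<le> D q"
  shows "mono_on {\<alpha>..\<beta>} f"
proof (rule mono_onI)
  fix r t assume rt: "r \<in> {\<alpha>..\<beta>}" "t \<in> {\<alpha>..\<beta>}" "r \<le> t"
  have "\<exists>q\<in>{r..t}. f t - f r = (\<lambda>h. D q * h) (t - r)"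
  proof (rule mvt_very_simple[OF rt(3)])
    fix q assume "r \<le> q" "q \<le> t"
    then have "q \<in> {\<alpha>..\<beta>}" "{r..t} \<subseteq> {\<alpha>..\<beta>}" using rt by auto
    then have "(f has_real_derivative D q) (at q within {r..t})"
      using DERIV_subset[OF D] by blast
    then show "(f has_derivative (\<lambda>h. D q * h)) (at q within {r..t})"
      unfolding has_field_derivative_def .
  qed
  then obtain q where q: "q \<in> {r..t}" "f t - f r = D q * (t - r)" by blast
  have "0 \<le> D q" using nonneg[of q] q(1) rt by simp
  then have "0 \<le> D q * (t - r)" using rt(3) by simp
  then show "f r \<le> f t" using q(2) by simp
qed

lemma has_vector_derivative_nth:
  "(f has_vector_derivative v) F \<Longrightarrow> ((\<lambda>q. f q $ s) has_real_derivative v $ s) F"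
  unfolding has_real_derivative_iff_has_vector_derivative
  by (rule bounded_linear.has_vector_derivative[OF bounded_linear_vec_nth])

section \<open>Gradients with positive, increasing derivative\<close>

text \<open>
  The properties of \<open>\<xi>\<close> that the argument uses: \<open>g s\<close> is its partial derivative in the variable \<open>s\<close> and
  \<open>H s t\<close> the second partial derivative in \<open>s\<close> and \<open>t\<close>. The Hessian is positive because of the quadratic
  terms and strictly increasing because of the cubic terms of a non-degenerate model.
\<close>

locale species_gradient =
  fixes g :: "'s::finite \<Rightarrow> real^'s \<Rightarrow> real" and H :: "'s \<Rightarrow> 's \<Rightarrow> real^'s \<Rightarrow> real"
  assumes g_deriv: "y \<in> wide_cube \<Longrightarrow> (g s has_derivative (\<lambda>v. \<Sum>t\<in>UNIV. H s t y * v $ t)) (at y)"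
    and H_cont: "continuous_on wide_cube (H s t)"
    and H_sym: "H s t = H t s"
    and H_pos: "0 \<le> y \<Longrightarrow> y \<in> wide_cube \<Longrightarrow> 0 < H s t y"
    and H_strict: "0 \<le> y \<Longrightarrow> y \<le> z \<Longrightarrow> y \<noteq> z \<Longrightarrow> z \<in> wide_cube \<Longrightarrow> H s t y < H s t z"
    and g_0: "g s 0 = 0"
begin

lemma wide_cube_down: "0 \<le> y \<Longrightarrow> y \<le> z \<Longrightarrow> z \<in> wide_cube \<Longrightarrow> y \<in> wide_cube"
  unfolding wide_cube_def less_eq_vec_def by (auto simp: abs_of_nonneg intro: order.strict_trans1) (meson abs_ge_self order_trans le_less_trans)

lemma H_mono: "0 \<le> y \<Longrightarrow> y \<le> z \<Longrightarrow> z \<in> wide_cube \<Longrightarrow> H s t y \<le> H s t z"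
  using H_strict[of y z s t] by (cases "y = z") auto

lemma g_cont: "continuous_on wide_cube (g s)"
  by (intro continuous_at_imp_continuous_on ballI has_derivative_continuous[OF g_deriv])

lemma g_segment:
  fixes y z :: "real^'s"
  assumes "y + u *\<^sub>R v \<in> wide_cube"
  shows "((\<lambda>u. g s (y + u *\<^sub>R v)) has_real_derivative (\<Sum>t\<in>UNIV. H s t (y + u *\<^sub>R v) * v $ t)) (at u)"
proof -
  have "((\<lambda>u. y + u *\<^sub>R v) has_derivative (\<lambda>du. du *\<^sub>R v)) (at u)"
    by (auto intro!: derivative_eq_intros)
  from diff_chain_at[OF this g_deriv[OF assms, of s]]
  show ?thesis
    unfolding has_field_derivative_def o_def
    by (rule has_derivative_eq_rhs) (auto simp: sum_distrib_left sum_distrib_right mult_ac)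
qed

lemma segment_bounds:
  fixes y z :: "real^'s"
  assumes "0 \<le> y" "y \<le> z" "0 \<le> u" "u \<le> 1"
  shows "0 \<le> y + u *\<^sub>R (z - y)" "y \<le> y + u *\<^sub>R (z - y)" "y + u *\<^sub>R (z - y) \<le> z"
proof -
  have *: "y $ s \<le> z $ s" "0 \<le> y $ s" for s using assms by (auto simp: less_eq_vec_def)
  have "0 \<le> u * (z $ s - y $ s)" "u * (z $ s - y $ s) \<le> z $ s - y $ s" for s
    using * assms(3,4) by (auto intro: mult_left_le_one_le)
  then show "0 \<le> y + u *\<^sub>R (z - y)" "y \<le> y + u *\<^sub>R (z - y)" "y + u *\<^sub>R (z - y) \<le> z"
    using * by (auto simp: less_eq_vec_def add.commute le_diff_eq intro!: add_nonneg_nonneg)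
qed

lemma g_mvt:
  assumes "0 \<le> y" "y \<le> z" "z \<in> wide_cube"
  obtains w where "y \<le> w" "w \<le> z" "y \<noteq> z \<Longrightarrow> w \<noteq> z"
    "g s z - g s y = (\<Sum>t\<in>UNIV. H s t w * (z $ t - y $ t))"
proof -
  note seg = segment_bounds[OF assms(1,2)]
  have wide: "y + u *\<^sub>R (z - y) \<in> wide_cube" if "0 \<le> u" "u \<le> 1" for u
    using wide_cube_down[OF seg(1,3)[OF that] assms(3)] .
  have "\<exists>u\<in>{0<..<1}. g s (y + 1 *\<^sub>R (z - y)) - g s (y + 0 *\<^sub>R (z - y))
      = (\<lambda>d. d * (\<Sum>t\<in>UNIV. H s t (y + u *\<^sub>R (z - y)) * (z - y) $ t)) (1 - 0)"
  proof (rule mvt_simple)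
    fix u :: real
    assume "0 \<le> u" "u \<le> 1"
    from g_segment[OF wide[OF this], of s]
    show "((\<lambda>u. g s (y + u *\<^sub>R (z - y))) has_derivative
        (\<lambda>d. d * (\<Sum>t\<in>UNIV. H s t (y + u *\<^sub>R (z - y)) * (z - y) $ t))) (at u within {0..1})"
      unfolding has_field_derivative_def mult_commute_abs by (rule has_derivative_at_withinI)
  qed simp
  then obtain u where u: "0 < u" "u < 1"
    "g s z - g s y = (\<Sum>t\<in>UNIV. H s t (y + u *\<^sub>R (z - y)) * (z $ t - y $ t))" by auto
  have "y + u *\<^sub>R (z - y) \<noteq> z" if "y \<noteq> z"
  proof
    assume "y + u *\<^sub>R (z - y) = z"
    then have "(1 - u) *\<^sub>R (z - y) = 0" unfolding scaleR_left_diff_distrib by (metis add_diff_cancel_left' diff_self scaleR_one)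
    then show False using u that by simp
  qed
  then show thesis
    using that[of "y + u *\<^sub>R (z - y)"] seg u by auto
qed

text \<open>
  Strict convexity of \<open>g s\<close> along increasing segments.
\<close>

lemma g_diff_less:
  assumes "0 \<le> y" "y \<le> z" "y \<noteq> z" "z \<in> wide_cube"
  shows "g s z - g s y < (\<Sum>t\<in>UNIV. H s t z * (z $ t - y $ t))"
proof -
  obtain w where w: "y \<le> w" "w \<le> z" "w \<noteq> z"
    "g s z - g s y = (\<Sum>t\<in>UNIV. H s t w * (z $ t - y $ t))"
    using g_mvt[OF assms(1,2,4), of s] assms(3) by metis
  have w0: "0 \<le> w" using assms(1) w(1) by (rule order_trans)
  obtain t where "y $ t \<noteq> z $ t" using assms(3) by (auto simp: vec_eq_iff)
  moreover have yz: "y $ t \<le> z $ t" for t using assms(2) by (simp add: less_eq_vec_def)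
  ultimately have t: "y $ t < z $ t" by (simp add: order_less_le)
  show ?thesis
    unfolding w(4)
  proof (rule sum_strict_mono_ex1)
    show "\<forall>t\<in>UNIV. H s t w * (z $ t - y $ t) \<le> H s t z * (z $ t - y $ t)"
      using H_mono[OF w0 w(2) assms(4)] yz by (auto intro!: mult_right_mono)
    show "\<exists>t\<in>UNIV. H s t w * (z $ t - y $ t) < H s t z * (z $ t - y $ t)"
      using H_strict[OF w0 w(2,3) assms(4)] t by (intro bexI[of _ t] mult_strict_right_mono) auto
  qed auto
qed

lemma g_diff_ge:
  assumes "0 \<le> y" "y \<le> z" "z \<in> wide_cube"
  shows "(\<Sum>t\<in>UNIV. H s t y * (z $ t - y $ t)) \<le> g s z - g s y"
proof -
  obtain w where w: "y \<le> w" "w \<le> z"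
    "g s z - g s y = (\<Sum>t\<in>UNIV. H s t w * (z $ t - y $ t))"
    using g_mvt[OF assms, of s] by metis
  have "H s t y \<le> H s t w" for t
    using assms w by (intro H_mono wide_cube_down[of w z]) (auto intro: order_trans)
  then show ?thesis
    unfolding w(3) using assms(2) by (intro sum_mono mult_right_mono) (auto simp: less_eq_vec_def)
qed

lemma g_mono:
  assumes "0 \<le> y" "y \<le> z" "z \<in> wide_cube"
  shows "g s y \<le> g s z"
proof -
  have "0 \<le> (\<Sum>t\<in>UNIV. H s t y * (z $ t - y $ t))"
    using assms H_pos[OF assms(1) wide_cube_down[OF assms]]
    by (intro sum_nonneg mult_nonneg_nonneg) (auto simp: less_eq_vec_def intro: less_imp_le)
  then show ?thesis using g_diff_ge[OF assms, of s] by linarith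
qed

lemma zero_wide: "(0 :: real^'s) \<in> wide_cube"
  by (simp add: wide_cube_def)

lemma g_nonneg: "0 \<le> y \<Longrightarrow> y \<in> wide_cube \<Longrightarrow> 0 \<le> g s y"
  using g_mono[of 0 y s] g_0 by simp

lemma g_pos:
  assumes "0 \<le> y" "y \<noteq> 0" "y \<in> wide_cube"
  shows "0 < g s y"
proof -
  obtain t where "y $ t \<noteq> 0" using assms(2) by (auto simp: vec_eq_iff)
  then have "0 < y $ t" using assms(1) by (auto simp: less_eq_vec_def order_less_le)
  then have "0 < (\<Sum>t\<in>UNIV. H s t 0 * (y $ t - 0 $ t))"
    using H_pos[OF order_refl zero_wide, of s] assms(1)
    by (intro sum_pos2[of _ t]) (auto simp: less_eq_vec_def intro!: mult_nonneg_nonneg less_imp_le[of 0 "H _ _ _"])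
  then show ?thesis using g_diff_ge[OF order_refl assms(1,3), of s] g_0 by simp
qed

text \<open>
  On a segment along which both \<open>p\<close> and \<open>y\<close> increase, \<open>p * g s y\<close> is convex, as its derivative is a sum
  of products of nonnegative increasing functions.
\<close>

lemma scaled_g_convex:
  fixes pa pb t :: real
  assumes "0 \<le> pa" "pa \<le> pb" "0 \<le> y" "y \<le> z" "z \<in> wide_cube" "0 \<le> t" "t \<le> 1"
  shows "(pa + t * (pb - pa)) * g s (y + t *\<^sub>R (z - y)) \<le> (1 - t) * (pa * g s y) + t * (pb * g s z)"
proof -
  note seg = segment_bounds[OF assms(3,4)]
  have wide: "y + u *\<^sub>R (z - y) \<in> wide_cube" if "0 \<le> u" "u \<le> 1" for u
    using wide_cube_down[OF seg(1,3)[OF that] assms(5)] .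
  define \<phi> where "\<phi> u = (pa + u * (pb - pa)) * g s (y + u *\<^sub>R (z - y))" for u
  define \<phi>' where "\<phi>' u = (pb - pa) * g s (y + u *\<^sub>R (z - y))
     + (\<Sum>r\<in>UNIV. H s r (y + u *\<^sub>R (z - y)) * (z - y) $ r) * (pa + u * (pb - pa))" for u
  have "convex_on {0..1} \<phi>"
  proof (rule convex_on_realI)
    show "(\<phi> has_real_derivative \<phi>' u) (at u)" if "u \<in> {0..1}" for u
      unfolding \<phi>_def \<phi>'_def using that
      by (intro DERIV_mult g_segment wide) (auto intro!: derivative_eq_intros)
    show "\<phi>' u \<le> \<phi>' u'" if u: "u \<in> {0..1}" "u' \<in> {0..1}" "u \<le> u'" for u u'
    proof -
      have le: "y + u *\<^sub>R (z - y) \<le> y + u' *\<^sub>R (z - y)"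
        using u assms(4) by (auto simp: less_eq_vec_def intro!: mult_right_mono)
      have "0 \<le> H s r (y + u' *\<^sub>R (z - y))" for r
        using u by (intro less_imp_le[OF H_pos] seg(1) wide) auto
      moreover have "0 \<le> (z - y) $ r" for r using assms(4) by (simp add: less_eq_vec_def)
      moreover have "H s r (y + u *\<^sub>R (z - y)) \<le> H s r (y + u' *\<^sub>R (z - y))" for r
        using seg(1) wide u le by (intro H_mono) auto
      moreover have "g s (y + u *\<^sub>R (z - y)) \<le> g s (y + u' *\<^sub>R (z - y))"
        using seg(1) wide u le by (intro g_mono) auto
      ultimately show ?thesis
        unfolding \<phi>'_def using u assms
        by (intro add_mono mult_mono[of "sum _ _"] mult_left_mono sum_mono mult_right_mono sum_nonneg
            mult_nonneg_nonneg add_nonneg_nonneg) auto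
    qed
  qed auto
  then have "\<phi> ((1 - t) *\<^sub>R 0 + t *\<^sub>R 1) \<le> (1 - t) * \<phi> 0 + t * \<phi> 1"
    by (rule convex_onD) (use assms in auto)
  then show ?thesis by (simp add: \<phi>_def)
qed

lemma deriv_along_curve:
  assumes "(p has_real_derivative p') (at q within S)" "(\<Phi> has_vector_derivative v) (at q within S)"
    and "\<Phi> q \<in> wide_cube"
  shows "((\<lambda>q. p q * g s (\<Phi> q)) has_real_derivative
      p' * g s (\<Phi> q) + p q * (\<Sum>t\<in>UNIV. H s t (\<Phi> q) * v $ t)) (at q within S)"
proof -
  have "((g s \<circ> \<Phi>) has_vector_derivative (\<Sum>t\<in>UNIV. H s t (\<Phi> q) * v $ t)) (at q within S)"
    by (rule vector_derivative_diff_chain_within[OF assms(2) has_derivative_at_withinI[OF g_deriv[OF assms(3)]]])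
  then have "((\<lambda>q. g s (\<Phi> q)) has_real_derivative (\<Sum>t\<in>UNIV. H s t (\<Phi> q) * v $ t)) (at q within S)"
    by (simp add: has_real_derivative_iff_has_vector_derivative o_def)
  from DERIV_mult[OF assms(1) this] show ?thesis by (simp add: algebra_simps)
qed

end

section \<open>The solution curve below a super-solvable point\<close>

text \<open>
  A super-solvable point \<open>x\<close>. The system is multiplied by \<open>\<lambda>_s\<close>, so that \<open>b s\<close> stands for
  \<open>\<lambda>_s * h_s^2\<close> and the constant \<open>Lam s\<close> below for \<open>\<lambda>_s * L_s\<close>; \<open>psd\<close> is the positivity of \<open>M_sym\<close>.
\<close>

locale super_solvable_point = species_gradient g H
  for g :: "'s::finite \<Rightarrow> real^'s \<Rightarrow> real" and H :: "'s \<Rightarrow> 's \<Rightarrow> real^'s \<Rightarrow> real" +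
  fixes lam :: "real^'s" and b :: "'s \<Rightarrow> real" and x :: "real^'s"
  assumes lam_pos: "0 < lam $ s"
    and b_nonneg: "0 \<le> b s"
    and x_pos: "0 < x $ s"
    and x_le_1: "x $ s \<le> 1"
    and psd: "(\<Sum>s\<in>UNIV. \<Sum>t\<in>UNIV. v $ s * (H s t x * v $ t))
               \<le> (\<Sum>s\<in>UNIV. (g s x + b s) / x $ s * (v $ s)\<^sup>2)"
begin

definition Lam :: "'s \<Rightarrow> real" where
  "Lam s = (g s x + b s) / x $ s"

text \<open>
  The first integral of the trajectory equation: \<open>y\<close> is a fixed point of \<open>T_p\<close> between 0 and \<open>x\<close>.
\<close>

definition sol :: "real \<Rightarrow> real^'s \<Rightarrow> bool" where
  "sol p y \<longleftrightarrow> 0 \<le> p \<and> p \<le> 1 \<and> 0 \<le> y \<and> y \<le> x \<and> (\<forall>s. Lam s * y $ s = p * g s y + b s)"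

text \<open>
  The points \<open>z\<close> between 0 and \<open>x\<close> with \<open>T_p(z) \<le> z\<close>.
\<close>

definition supersol :: "real \<Rightarrow> (real^'s) set" where
  "supersol p = {z. 0 \<le> z \<and> z \<le> x \<and> (\<forall>s. p * g s z + b s \<le> Lam s * z $ s)}"

lemma x_nonneg: "0 \<le> x"
  using x_pos by (auto simp: less_eq_vec_def intro: less_imp_le)

lemma x_wide: "x \<in> wide_cube"
proof -
  have "\<bar>x $ s\<bar> < 2" for s using x_pos[of s] x_le_1[of s] by linarith
  then show ?thesis by (simp add: wide_cube_def)
qed

lemma x_nonzero: "x \<noteq> 0"
  using x_pos by (metis less_irrefl zero_index)

lemma below_x_wide: "0 \<le> y \<Longrightarrow> y \<le> x \<Longrightarrow> y \<in> wide_cube"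
  using wide_cube_down x_wide by blast

lemma Lam_pos: "0 < Lam s"
  unfolding Lam_def using g_pos[OF x_nonneg x_nonzero x_wide] b_nonneg x_pos
  by (intro divide_pos_pos add_pos_nonneg) auto

lemma sol_x: "sol 1 x"
  unfolding sol_def Lam_def using x_nonneg x_pos by (auto simp: less_imp_neq[symmetric])

text \<open>
  On nonnegative vectors the quadratic form at \<open>x\<close> bounds those at all earlier points, as the Hessian is
  increasing.
\<close>

lemma psd_scaled:
  assumes p: "0 \<le> p" "p \<le> 1" and y: "0 \<le> y" "y \<le> x" and v: "0 \<le> v"
  shows "(\<Sum>s\<in>UNIV. v $ s * (p * (\<Sum>t\<in>UNIV. H s t y * v $ t))) \<le> (\<Sum>s\<in>UNIV. Lam s * (v $ s)\<^sup>2)"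
proof -
  have v': "0 \<le> v $ s" for s using v by (simp add: less_eq_vec_def)
  have H0: "0 \<le> H s t y" for s t
    using H_pos[OF y(1) below_x_wide[OF y]] by (rule less_imp_le)
  have "p * (\<Sum>t\<in>UNIV. H s t y * v $ t) \<le> 1 * (\<Sum>t\<in>UNIV. H s t x * v $ t)" for s
    using p v' H0 H_mono[OF y x_wide]
    by (intro mult_mono sum_mono mult_right_mono sum_nonneg mult_nonneg_nonneg) auto
  then have "(\<Sum>s\<in>UNIV. v $ s * (p * (\<Sum>t\<in>UNIV. H s t y * v $ t)))
      \<le> (\<Sum>s\<in>UNIV. v $ s * (\<Sum>t\<in>UNIV. H s t x * v $ t))"
    using v' by (intro sum_mono mult_left_mono) auto
  also have "\<dots> \<le> (\<Sum>s\<in>UNIV. Lam s * (v $ s)\<^sup>2)"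
    using psd[of v] unfolding Lam_def by (simp add: sum_distrib_left)
  finally show ?thesis .
qed

text \<open>
  Comparable solutions coincide. Strict convexity makes the difference \<open>v\<close> of two solutions violate
  \<open>psd_scaled\<close>. The case \<open>p = 1\<close> is included.
\<close>

lemma sol_unique_le:
  assumes "sol p y" "sol p z" "y \<le> z"
  shows "y = z"
proof (rule ccontr)
  assume ne: "y \<noteq> z"
  define v where "v = z - y"
  have v0: "0 \<le> v" using assms(3) by (simp add: v_def less_eq_vec_def)
  have p: "0 \<le> p" "p \<le> 1" and y: "0 \<le> y" "y \<le> x" and z: "0 \<le> z" "z \<le> x"
    using assms by (auto simp: sol_def)
  have Lv: "Lam s * v $ s = p * (g s z - g s y)" for s
    using assms(1,2) by (simp add: sol_def v_def algebra_simps)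
  obtain s where "y $ s \<noteq> z $ s" using ne by (auto simp: vec_eq_iff)
  then have s: "v $ s \<noteq> 0" by (simp add: v_def)
  then have vs: "0 < v $ s" using v0 by (auto simp: less_eq_vec_def order_less_le)
  have "p \<noteq> 0" using Lv[of s] s Lam_pos[of s] by auto
  then have strict: "Lam r * v $ r < p * (\<Sum>t\<in>UNIV. H r t z * v $ t)" for r
    unfolding Lv using g_diff_less[OF y(1) assms(3) ne below_x_wide[OF z], of r] p(1)
    by (simp add: v_def)
  have "(\<Sum>r\<in>UNIV. Lam r * (v $ r)\<^sup>2) < (\<Sum>r\<in>UNIV. v $ r * (p * (\<Sum>t\<in>UNIV. H r t z * v $ t)))"
  proof (rule sum_strict_mono_ex1)
    show "\<forall>r\<in>UNIV. Lam r * (v $ r)\<^sup>2 \<le> v $ r * (p * (\<Sum>t\<in>UNIV. H r t z * v $ t))"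
    proof
      fix r
      have "v $ r * (Lam r * v $ r) \<le> v $ r * (p * (\<Sum>t\<in>UNIV. H r t z * v $ t))"
        using strict[of r] v0 by (intro mult_left_mono) (auto simp: less_eq_vec_def)
      then show "Lam r * (v $ r)\<^sup>2 \<le> v $ r * (p * (\<Sum>t\<in>UNIV. H r t z * v $ t))"
        by (simp add: power2_eq_square mult_ac)
    qed
    have "v $ s * (Lam s * v $ s) < v $ s * (p * (\<Sum>t\<in>UNIV. H s t z * v $ t))"
      using strict[of s] vs by (rule mult_strict_left_mono)
    then show "\<exists>r\<in>UNIV. Lam r * (v $ r)\<^sup>2 < v $ r * (p * (\<Sum>t\<in>UNIV. H r t z * v $ t))"
      by (intro bexI[of _ s]) (simp_all add: power2_eq_square mult_ac)
  qed auto
  then show False using psd_scaled[OF p z v0] by linarith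
qed

text \<open>
  The Knaster-Tarski construction: the infimum \<open>y\<close> of the supersolutions is a supersolution, hence so is
  its image \<open>y'\<close>, and minimality forces \<open>y' = y\<close>. No continuity is needed.
\<close>

lemma least_sol_exists:
  assumes p: "0 \<le> p" "p \<le> 1"
  shows "\<exists>y. sol p y \<and> (\<forall>z\<in>supersol p. y \<le> z)"
proof -
  have "p * g s x + b s \<le> Lam s * x $ s" for s
    using p g_nonneg[OF x_nonneg x_wide, of s] x_pos[of s]
    by (simp add: Lam_def mult_left_le_one_le)
  then have xA: "x \<in> supersol p" using x_nonneg by (simp add: supersol_def)
  define y where "y = (\<chi> s. INF z\<in>supersol p. z $ s)"
  have bdd: "bdd_below ((\<lambda>z. z $ s) ` supersol p)" for s
    by (rule bdd_belowI2[of _ 0]) (auto simp: supersol_def less_eq_vec_def)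
  have y_le: "y \<le> z" if "z \<in> supersol p" for z
    unfolding y_def less_eq_vec_def using cINF_lower[OF bdd that] by simp
  have y0: "0 \<le> y"
    unfolding y_def less_eq_vec_def using xA
    by (auto intro!: cINF_greatest simp: supersol_def less_eq_vec_def)
  have yx: "y \<le> x" using y_le xA .
  have "(p * g s y + b s) / Lam s \<le> y $ s" for s
  proof -
    have "(p * g s y + b s) / Lam s \<le> z $ s" if z: "z \<in> supersol p" for z
    proof -
      have "p * g s y + b s \<le> p * g s z + b s"
        using z p y_le[OF z] y0 by (auto intro!: mult_left_mono g_mono below_x_wide simp: supersol_def)
      also have "\<dots> \<le> Lam s * z $ s" using z by (simp add: supersol_def)
      finally show ?thesis using Lam_pos[of s] by (simp add: divide_le_eq mult.commute)
    qed
    then show ?thesis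
      unfolding y_def using xA by (auto intro!: cINF_greatest)
  qed
  then have y_super: "p * g s y + b s \<le> Lam s * y $ s" for s
    using Lam_pos[of s] by (simp add: divide_le_eq mult.commute)
  define y' where "y' = (\<chi> s. (p * g s y + b s) / Lam s)"
  have Ly': "Lam s * y' $ s = p * g s y + b s" for s
    using Lam_pos[of s] by (simp add: y'_def)
  have y'0: "0 \<le> y'"
    unfolding y'_def less_eq_vec_def using p b_nonneg Lam_pos g_nonneg[OF y0 below_x_wide[OF y0 yx]]
    by (auto intro!: divide_nonneg_pos add_nonneg_nonneg mult_nonneg_nonneg)
  have y'y: "y' \<le> y"
    unfolding less_eq_vec_def using y_super Ly' Lam_pos by (metis mult_le_cancel_left_pos)
  have "p * g s y' + b s \<le> Lam s * y' $ s" for s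
    unfolding Ly' using p y'0 y'y by (auto intro!: mult_left_mono g_mono below_x_wide y0 yx)
  then have "y' \<in> supersol p" using y'0 y'y yx by (auto simp: supersol_def)
  then have "y' = y" using y_le y'y by (blast intro: antisym)
  then have "sol p y" using p y0 yx Ly' by (simp add: sol_def)
  then show ?thesis using y_le by blast
qed

text \<open>
  The least solution for the parameter \<open>p\<close>, which by \<open>sol_eq_branch\<close> is the only one.
\<close>

definition branch :: "real \<Rightarrow> real^'s" where
  "branch p = (SOME y. sol p y \<and> (\<forall>z\<in>supersol p. y \<le> z))"

lemma
  assumes "0 \<le> p" "p \<le> 1"
  shows sol_branch: "sol p (branch p)" and branch_least: "z \<in> supersol p \<Longrightarrow> branch p \<le> z"
  using someI_ex[OF least_sol_exists[OF assms]] unfolding branch_def by auto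

lemma sol_eq_branch: "sol p y \<Longrightarrow> y = branch p"
proof -
  assume S: "sol p y"
  then have p: "0 \<le> p" "p \<le> 1" and "y \<in> supersol p"
    by (auto simp: sol_def supersol_def)
  then show "y = branch p"
    using sol_unique_le[OF sol_branch[OF p] S branch_least[OF p]] by simp
qed

lemma branch_1: "branch 1 = x"
  using sol_eq_branch[OF sol_x] by simp

text \<open>
  Without external field 0 would be a second solution for \<open>p = 1\<close>.
\<close>

lemma b_pos_ex: "\<exists>s. 0 < b s"
proof (rule ccontr)
  assume "\<not> ?thesis"
  then have "b s = 0" for s using b_nonneg[of s] by (simp add: order_less_le)
  then have "sol 1 0" using x_nonneg by (simp add: sol_def g_0)
  then show False using sol_eq_branch[OF \<open>sol 1 0\<close>] sol_eq_branch[OF sol_x] x_nonzero by simp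
qed

lemma sol_nonzero: "sol p y \<Longrightarrow> y \<noteq> 0"
  using b_pos_ex by (auto simp: sol_def g_0)

lemma sol_wide: "sol p y \<Longrightarrow> y \<in> wide_cube"
  using below_x_wide by (auto simp: sol_def)

lemma sol_g_pos: "sol p y \<Longrightarrow> 0 < g s y"
  using g_pos[OF _ sol_nonzero sol_wide] by (auto simp: sol_def)

lemma sol_pos: "sol p y \<Longrightarrow> 0 < p \<Longrightarrow> 0 < y $ s"
proof -
  assume S: "sol p y" and "0 < p"
  then have "0 < Lam s * y $ s"
    using sol_g_pos[OF S, of s] b_nonneg[of s] by (auto simp: sol_def intro: add_pos_nonneg)
  then show ?thesis using Lam_pos[of s] by (simp add: zero_less_mult_iff)
qed

lemma branch_mono:
  assumes "0 \<le> p" "p \<le> p'" "p' \<le> 1"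
  shows "branch p \<le> branch p'"
proof -
  have S: "sol p' (branch p')" using sol_branch assms by simp
  have "p * g s (branch p') \<le> p' * g s (branch p')" for s
    using assms(2) sol_g_pos[OF S, of s] by (simp add: mult_right_mono)
  then show ?thesis
    using S assms by (intro branch_least) (auto simp: supersol_def sol_def)
qed

lemma branch_neq:
  assumes "0 \<le> p" "p < p'" "p' \<le> 1"
  shows "branch p \<noteq> branch p'"
proof
  assume eq: "branch p = branch p'"
  have S: "sol p (branch p)" "sol p' (branch p')" using sol_branch assms by auto
  have "p * g s (branch p) = p' * g s (branch p)" for s
    using S unfolding sol_def eq by (metis add_right_cancel)
  then have "p = p'" using sol_g_pos[OF S(1)] by (metis less_irrefl mult_right_cancel)
  then show False using assms(2) by simp
qed

text \<open>
  A convex combination of two solutions is a supersolution for the averaged parameter.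
\<close>

lemma branch_convex:
  assumes "0 \<le> pa" "pa \<le> pb" "pb \<le> 1" "0 \<le> t" "t \<le> 1"
  shows "branch ((1 - t) * pa + t * pb) \<le> (1 - t) *\<^sub>R branch pa + t *\<^sub>R branch pb"
proof -
  have S: "sol pa (branch pa)" "sol pb (branch pb)" using sol_branch assms by auto
  have le: "branch pa \<le> branch pb" using branch_mono assms by simp
  define p where "p = (1 - t) * pa + t * pb"
  define z where "z = (1 - t) *\<^sub>R branch pa + t *\<^sub>R branch pb"
  have p_eq: "p = pa + t * (pb - pa)" and z_eq: "z = branch pa + t *\<^sub>R (branch pb - branch pa)"
    by (simp_all add: p_def z_def algebra_simps)
  have "t * (pb - pa) \<le> pb - pa" "0 \<le> t * (pb - pa)" using assms by (auto intro: mult_left_le_one_le)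
  then have p: "0 \<le> p" "p \<le> 1" using assms unfolding p_eq by linarith+
  have seg: "0 \<le> z" "z \<le> branch pb"
    unfolding z_eq using segment_bounds[OF _ le] S assms by (auto simp: sol_def)
  have "p * g s z + b s \<le> Lam s * z $ s" for s
  proof -
    have "p * g s z \<le> (1 - t) * (pa * g s (branch pa)) + t * (pb * g s (branch pb))"
      unfolding p_eq z_eq using S sol_wide[OF S(2)] le assms
      by (intro scaled_g_convex) (auto simp: sol_def)
    also have "\<dots> = (1 - t) * (Lam s * branch pa $ s - b s) + t * (Lam s * branch pb $ s - b s)"
      using S by (simp add: sol_def)
    also have "\<dots> = Lam s * z $ s - b s"
      by (simp add: z_def algebra_simps)
    finally show ?thesis by simp
  qed
  then have "z \<in> supersol p"
    using seg S(2) by (auto simp: supersol_def sol_def)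
  then show ?thesis
    using branch_least[OF p] unfolding p_def z_def by blast
qed

lemma compact_sol: "compact {c. sol (fst c) (snd c)}"
proof -
  define S where "S = {0..1::real} \<times> {0..x}"
  have "S \<subseteq> UNIV \<times> wide_cube" using below_x_wide by (auto simp: S_def)
  then have cont: "continuous_on S (\<lambda>c. g s (snd c))" for s
    by (intro continuous_on_compose2[OF g_cont] continuous_intros) auto
  have "compact S" unfolding S_def by (intro compact_Times compact_Icc) (simp add: interval_cbox)
  have eq: "{c. sol (fst c) (snd c)} = S \<inter> (\<Inter>s. S \<inter> (\<lambda>c. Lam s * snd c $ s - (fst c * g s (snd c) + b s)) -` {0})"
    by (auto simp: sol_def S_def)
  show ?thesis
    unfolding eq using \<open>compact S\<close>
    by (intro compact_Int_closed closed_INT ballI continuous_closed_preimage continuous_intros cont)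
       (auto intro: compact_imp_closed)
qed

text \<open>
  The projection of the compact solution set to the parameter is a bijection onto \<open>[0, 1]\<close>, hence its
  inverse is continuous.
\<close>

lemma continuous_on_branch: "continuous_on {0..1} branch"
proof -
  define K where "K = {c. sol (fst c) (snd c)}"
  have img: "fst ` K = {0..1}"
  proof
    show "fst ` K \<subseteq> {0..1}" by (auto simp: K_def sol_def)
    show "{0..1} \<subseteq> fst ` K"
    proof
      fix p :: real assume "p \<in> {0..1}"
      then have "(p, branch p) \<in> K" using sol_branch by (simp add: K_def)
      then show "p \<in> fst ` K" by (rule image_eqI[rotated]) simp
    qed
  qed
  have "continuous_on (fst ` K) (\<lambda>p. (p, branch p))"
  proof (rule continuous_on_inv)
    show "continuous_on K fst" by (intro continuous_intros)
    show "compact K" unfolding K_def by (rule compact_sol)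
    show "\<forall>c\<in>K. (fst c, branch (fst c)) = c"
      using sol_eq_branch by (simp add: K_def prod_eq_iff)
  qed
  then have "continuous_on {0..1} (\<lambda>p. snd (p, branch p))"
    unfolding img by (rule continuous_on_snd)
  then show ?thesis by simp
qed

text \<open>
  The time \<open>q\<close> at which the trajectory passes through the solution with parameter \<open>p\<close>.
\<close>

definition level :: "real \<Rightarrow> real" where
  "level p = inner lam (branch p)"

lemma inner_lam: "inner lam y = (\<Sum>s\<in>UNIV. lam $ s * y $ s)"
  by (simp add: inner_vec_def)

lemma inner_lam_mono: "y \<le> z \<Longrightarrow> inner lam y \<le> inner lam z"
  unfolding inner_lam less_eq_vec_def using lam_pos
  by (intro sum_mono mult_left_mono less_imp_le[OF lam_pos]) simp

lemma inner_lam_strict_mono: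
  assumes "y \<le> z" "y \<noteq> z"
  shows "inner lam y < inner lam z"
proof -
  obtain s where "y $ s \<noteq> z $ s" using assms(2) by (auto simp: vec_eq_iff)
  then have s: "y $ s < z $ s" using assms(1) by (simp add: less_eq_vec_def order_less_le)
  show ?thesis
    unfolding inner_lam
  proof (rule sum_strict_mono_ex1)
    show "\<forall>s\<in>UNIV. lam $ s * y $ s \<le> lam $ s * z $ s"
      using assms(1) lam_pos by (auto simp: less_eq_vec_def intro!: mult_left_mono less_imp_le)
    show "\<exists>s\<in>UNIV. lam $ s * y $ s < lam $ s * z $ s"
      using s lam_pos by (intro bexI[of _ s] mult_strict_left_mono) auto
  qed auto
qed

lemma level_less: "0 \<le> p \<Longrightarrow> p < p' \<Longrightarrow> p' \<le> 1 \<Longrightarrow> level p < level p'"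
  unfolding level_def by (intro inner_lam_strict_mono branch_mono branch_neq) auto

lemma level_le_iff: "p \<in> {0..1} \<Longrightarrow> p' \<in> {0..1} \<Longrightarrow> level p \<le> level p' \<longleftrightarrow> p \<le> p'"
  using level_less[of p p'] level_less[of p' p] by (cases p p' rule: linorder_cases) simp_all

lemma inj_on_level: "inj_on level {0..1}"
  by (rule inj_onI) (simp add: order_eq_iff level_le_iff)

lemma continuous_on_level: "continuous_on {0..1} level"
  unfolding level_def by (intro continuous_intros continuous_on_branch)

lemma level_image: "level ` {0..1} = {level 0..level 1}"
proof (intro equalityI subsetI)
  fix q assume "q \<in> {level 0..level 1}"
  then show "q \<in> level ` {0..1}"
    using IVT'[of level 0 q 1] continuous_on_level by auto
qed (auto simp: level_le_iff)

lemma convex_on_level: "convex_on {0..1} level"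
proof (rule convex_on_linorderI)
  fix t p p' :: real
  assume "0 < t" "t < 1" "p \<in> {0..1}" "p' \<in> {0..1}" "p < p'"
  then show "level ((1 - t) *\<^sub>R p + t *\<^sub>R p') \<le> (1 - t) * level p + t * level p'"
    using inner_lam_mono[OF branch_convex[of p p' t]]
    by (simp add: level_def inner_add_right)
qed auto

text \<open>
  The trajectory, parametrized by \<open>q\<close> in \<open>[level 0, level 1]\<close>.
\<close>

definition pcurve :: "real \<Rightarrow> real" where
  "pcurve = inv_into {0..1} level"

definition ycurve :: "real \<Rightarrow> real^'s" where
  "ycurve q = branch (pcurve q)"

lemma
  assumes "q \<in> {level 0..level 1}"
  shows pcurve_range: "pcurve q \<in> {0..1}" and level_pcurve: "level (pcurve q) = q"
  using assms unfolding pcurve_def level_image[symmetric]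
  by (rule inv_into_into, rule f_inv_into_f)

lemma pcurve_level: "p \<in> {0..1} \<Longrightarrow> pcurve (level p) = p"
  unfolding pcurve_def using inj_on_level by simp

lemma sol_curve:
  assumes "q \<in> {level 0..level 1}"
  shows "sol (pcurve q) (ycurve q)" "inner lam (ycurve q) = q"
  using pcurve_range[OF assms] level_pcurve[OF assms] sol_branch
  unfolding ycurve_def level_def by auto

lemma sol_on_curve:
  assumes "sol p y"
  shows "inner lam y \<in> {level 0..level 1}" "p = pcurve (inner lam y)" "y = ycurve (inner lam y)"
proof -
  have p: "p \<in> {0..1}" using assms by (simp add: sol_def)
  have l: "inner lam y = level p" unfolding level_def sol_eq_branch[OF assms] ..
  show "inner lam y \<in> {level 0..level 1}" using p level_image l by blast
  show p_eq: "p = pcurve (inner lam y)" using pcurve_level[OF p] l by simp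
  show "y = ycurve (inner lam y)" unfolding ycurve_def using p_eq sol_eq_branch[OF assms] by simp
qed

lemma level_1: "level 1 = inner lam x"
  by (simp add: level_def branch_1)

lemma level_0_less_1: "level 0 < level 1"
  by (rule level_less) auto

lemma pcurve_ends: "pcurve (level 0) = 0" "pcurve (level 1) = 1"
  by (simp_all add: pcurve_level)

lemma ycurve_end: "ycurve (level 1) = x"
  by (simp add: ycurve_def pcurve_ends branch_1)

lemma pcurve_le_iff:
  "q \<in> {level 0..level 1} \<Longrightarrow> q' \<in> {level 0..level 1} \<Longrightarrow> pcurve q \<le> pcurve q' \<longleftrightarrow> q \<le> q'"
  using level_le_iff[OF pcurve_range pcurve_range, of q q'] level_pcurve by simp

lemma ycurve_mono:
  "q \<in> {level 0..level 1} \<Longrightarrow> q' \<in> {level 0..level 1} \<Longrightarrow> q \<le> q' \<Longrightarrow> ycurve q \<le> ycurve q'"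
  unfolding ycurve_def using pcurve_range pcurve_le_iff by (intro branch_mono) auto

lemma continuous_on_pcurve: "continuous_on {level 0..level 1} pcurve"
  unfolding level_image[symmetric] using pcurve_level
  by (intro continuous_on_inv continuous_on_level) auto

lemma continuous_on_ycurve: "continuous_on {level 0..level 1} ycurve"
  unfolding ycurve_def using pcurve_range
  by (intro continuous_on_compose2[OF continuous_on_branch continuous_on_pcurve]) auto

lemma concave_on_pcurve: "concave_on {level 0..level 1} pcurve"
proof -
  have "convex_on {level 0..level 1} (\<lambda>q. - pcurve q)"
  proof (rule convex_onI)
    fix t q q' :: real
    assume t: "0 < t" "t < 1" and q: "q \<in> {level 0..level 1}" "q' \<in> {level 0..level 1}"
    define p where "p = (1 - t) * pcurve q + t * pcurve q'"
    define r where "r = (1 - t) * q + t * q'"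
    have p: "p \<in> {0..1}"
      unfolding p_def using convexD_alt[of "{0..1::real}" "pcurve q" "pcurve q'" t] pcurve_range q t by auto
    have r: "r \<in> {level 0..level 1}"
      unfolding r_def using convexD_alt[of "{level 0..level 1}" q q' t] q t by auto
    have "level p \<le> r"
      unfolding p_def r_def
      using convex_onD[OF convex_on_level, of t "pcurve q" "pcurve q'"] t pcurve_range q level_pcurve by simp
    then have "p \<le> pcurve r"
      using level_le_iff[OF p pcurve_range[OF r]] level_pcurve[OF r] by simp
    then show "- pcurve ((1 - t) *\<^sub>R q + t *\<^sub>R q') \<le> (1 - t) * - pcurve q + t * - pcurve q'"
      by (simp add: p_def r_def)
  qed auto
  then show ?thesis by (simp add: concave_on_def)
qed

text \<open>
  The differential of \<open>(p, y) \<mapsto> (\<langle>\<lambda>, y\<rangle>, (Lam s * y_s - p * g s y)_s)\<close> is injective at solutions. For \<open>a \<ge> 0\<close>,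
  pairing the equation with the negative part \<open>n\<close> of \<open>v\<close> and using \<open>psd_scaled\<close> for \<open>n\<close> shows that \<open>v\<close>
  does not change sign: for \<open>p > 0\<close> because all entries of \<open>H\<close> are positive, for \<open>p = 0\<close> because the
  system is diagonal. A vector of constant sign that is orthogonal to \<open>\<lambda>\<close> vanishes. The case \<open>a < 0\<close>
  reduces to this one by a change of sign.
\<close>

lemma linearized_injective:
  assumes S: "sol p y" and lv: "inner lam v = 0"
    and eq: "\<And>s. Lam s * v $ s = a * g s y + p * (\<Sum>t\<in>UNIV. H s t y * v $ t)"
  shows "a = 0 \<and> v = 0"
proof -
  have main: "a = 0 \<and> v = 0"
    if a: "0 \<le> a" and lv: "inner lam v = 0"
      and eq: "\<And>s. Lam s * v $ s = a * g s y + p * (\<Sum>t\<in>UNIV. H s t y * v $ t)"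
    for a and v :: "real^'s"
  proof -
    define n where "n = (\<chi> s. max 0 (- (v $ s)))"
    define P where "P = (\<chi> s. max 0 (v $ s))"
    have n0: "0 \<le> n $ s" and P0: "0 \<le> P $ s" for s by (auto simp: n_def P_def)
    have vPn: "v $ t = P $ t - n $ t" for t by (simp add: n_def P_def)
    have nv: "n $ s * v $ s = - (n $ s)\<^sup>2" for s
      by (simp add: n_def max_def power2_eq_square)
    have p: "0 \<le> p" "p \<le> 1" and y: "0 \<le> y" "y \<le> x" using S by (auto simp: sol_def)
    have Hp: "0 < H s t y" for s t using H_pos[OF y(1) sol_wide[OF S]] .
    have gp: "0 < g s y" for s using sol_g_pos[OF S] .
    define A where "A = (\<Sum>s\<in>UNIV. n $ s * (p * (\<Sum>t\<in>UNIV. H s t y * P $ t)))"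
    define C where "C = (\<Sum>s\<in>UNIV. n $ s * (p * (\<Sum>t\<in>UNIV. H s t y * n $ t)))"
    define E where "E = (\<Sum>s\<in>UNIV. n $ s * (a * g s y))"
    define Q where "Q = (\<Sum>s\<in>UNIV. Lam s * (n $ s)\<^sup>2)"
    have "n $ s * (Lam s * v $ s) = n $ s * (a * g s y) + n $ s * (p * (\<Sum>t\<in>UNIV. H s t y * P $ t))
        - n $ s * (p * (\<Sum>t\<in>UNIV. H s t y * n $ t))" for s
      unfolding eq by (simp add: vPn right_diff_distrib sum_subtractf distrib_left)
    moreover have "n $ s * (Lam s * v $ s) = - (Lam s * (n $ s)\<^sup>2)" for s
      using nv[of s] by (metis mult.left_commute mult_minus_right)
    ultimately have "- Q = E + A - C"
      unfolding Q_def E_def A_def C_def by (simp add: sum.distrib sum_subtractf sum_negf[symmetric])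
    moreover have "C \<le> Q"
      unfolding C_def Q_def using p y n0 by (intro psd_scaled) (auto simp: less_eq_vec_def)
    moreover have "0 \<le> E"
      unfolding E_def using a n0 gp by (intro sum_nonneg mult_nonneg_nonneg) (auto intro: less_imp_le)
    moreover have "0 \<le> A"
      unfolding A_def using p n0 P0 Hp
      by (intro sum_nonneg mult_nonneg_nonneg) (auto intro: less_imp_le)
    ultimately have A: "A = 0" and QC: "C = Q" by auto
    have one_sign: "n = 0 \<or> P = 0"
    proof (rule ccontr)
      assume "\<not> ?thesis"
      then obtain s t where "n $ s \<noteq> 0" "P $ t \<noteq> 0" by (auto simp: vec_eq_iff)
      then have s: "0 < n $ s" and t: "0 < P $ t" using n0[of s] P0[of t] by auto
      show False
      proof (cases "p = 0")
        case True
        then have "Q = 0" using QC by (simp add: C_def)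
        moreover have "0 < Q"
          unfolding Q_def using s Lam_pos
          by (intro sum_pos2[of _ s]) (auto intro!: mult_nonneg_nonneg intro: less_imp_le)
        ultimately show False by simp
      next
        case False
        have "0 < (\<Sum>t\<in>UNIV. H s t y * P $ t)"
          using t P0 Hp by (intro sum_pos2[of _ t]) (auto intro!: mult_nonneg_nonneg intro: less_imp_le)
        then have "0 < A"
          unfolding A_def using s p False n0 P0 Hp
          by (intro sum_pos2[of _ s]) (auto intro!: sum_nonneg mult_nonneg_nonneg less_imp_le[of 0 "H _ _ _"])
        then show False using A by simp
      qed
    qed
    have "v = 0"
    proof (rule ccontr)
      assume "v \<noteq> 0"
      moreover have "0 \<le> v \<or> v \<le> 0"
        using one_sign vPn n0 P0 unfolding less_eq_vec_def by (metis diff_0 diff_zero neg_le_0_iff_le zero_index)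
      ultimately show False
        using inner_lam_strict_mono[of 0 v] inner_lam_strict_mono[of v 0] lv by auto
    qed
    then have "a * g s y = 0" for s using eq[of s] by simp
    then show ?thesis using gp \<open>v = 0\<close> by (metis less_irrefl mult_eq_0_iff)
  qed
  show ?thesis
  proof (cases "0 \<le> a")
    case True
    then show ?thesis using main lv eq by blast
  next
    case False
    have "- a = 0 \<and> - v = 0"
    proof (rule main)
      show "Lam s * (- v) $ s = - a * g s y + p * (\<Sum>t\<in>UNIV. H s t y * (- v) $ t)" for s
        using eq[of s] by (simp add: sum_negf)
    qed (use False lv in auto)
    then show ?thesis by simp
  qed
qed

text \<open>
  The trajectory is continuously differentiable, solves the differential system, and has strictly
  increasing components up to the endpoints.
\<close>

lemma curve_C1:
  obtains p' y' where
    "continuous_on {level 0..level 1} p'" "continuous_on {level 0..level 1} y'"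
    "\<And>q. q \<in> {level 0..level 1} \<Longrightarrow> (pcurve has_real_derivative p' q) (at q within {level 0..level 1})"
    "\<And>q. q \<in> {level 0..level 1} \<Longrightarrow> (ycurve has_vector_derivative y' q) (at q within {level 0..level 1})"
    "\<And>q s. q \<in> {level 0..level 1} \<Longrightarrow>
       Lam s * y' q $ s = p' q * g s (ycurve q) + pcurve q * (\<Sum>t\<in>UNIV. H s t (ycurve q) * y' q $ t)"
    "\<And>q. q \<in> {level 0..level 1} \<Longrightarrow> inner lam (y' q) = 1"
    "\<And>q. q \<in> {level 0..level 1} \<Longrightarrow> 0 \<le> p' q"
    "\<And>q s. q \<in> {level 0..level 1} \<Longrightarrow> 0 < y' q $ s"
proof -
  define I where "I = {level 0..level 1}"
  define G where "G c = (inner lam (snd c), \<chi> s. Lam s * snd c $ s - fst c * g s (snd c))"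
    for c :: "real \<times> (real^'s)"
  define DG where "DG q w = (inner lam (snd w),
      \<chi> s. Lam s * snd w $ s - (pcurve q * (\<Sum>t\<in>UNIV. H s t (ycurve q) * snd w $ t) + fst w * g s (ycurve q)))"
    for q and w :: "real \<times> (real^'s)"
  define c where "c q = (pcurve q, ycurve q)" for q
  have c: "continuous_on I c"
    unfolding c_def I_def by (intro continuous_intros continuous_on_pcurve continuous_on_ycurve)
  have S: "sol (pcurve q) (ycurve q)" if "q \<in> I" for q using sol_curve that by (simp add: I_def)
  have G_deriv: "(G has_derivative DG q) (at (c q))" if q: "q \<in> I" for q
  proof -
    have nth: "((\<lambda>c. snd c $ s) has_derivative (\<lambda>w. snd w $ s)) (at (c q))" for s :: 's
      by (intro bounded_linear_imp_has_derivative bounded_linear_compose[OF bounded_linear_vec_nth bounded_linear_snd])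
    have gd: "((\<lambda>c. g s (snd c)) has_derivative (\<lambda>w. \<Sum>t\<in>UNIV. H s t (ycurve q) * snd w $ t)) (at (c q))" for s
    proof -
      have "(g s has_derivative (\<lambda>v. \<Sum>t\<in>UNIV. H s t (ycurve q) * v $ t)) (at (snd (c q)))"
        using g_deriv[OF sol_wide[OF S[OF q]]] by (simp add: c_def)
      from diff_chain_at[OF has_derivative_snd[OF has_derivative_ident] this]
      show ?thesis by (simp add: o_def)
    qed
    have "((\<lambda>c. \<chi> s. Lam s * snd c $ s - fst c * g s (snd c)) has_derivative
      (\<lambda>w. \<chi> s. Lam s * snd w $ s - (fst (c q) * (\<Sum>t\<in>UNIV. H s t (ycurve q) * snd w $ t) + fst w * g s (snd (c q)))))
       (at (c q))"
      by (rule has_derivative_vecI) (simp, intro derivative_intros nth gd)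
    then show ?thesis
      unfolding G_def DG_def
      by (intro has_derivative_Pair has_derivative_inner_right has_derivative_snd has_derivative_ident)
         (simp_all add: c_def)
  qed
  have DG_cont: "continuous_on I (\<lambda>q. DG q w)" for w
  proof -
    have "ycurve ` I \<subseteq> wide_cube" using S sol_wide by blast
    then have "continuous_on I (\<lambda>q. g s (ycurve q))" "continuous_on I (\<lambda>q. H s t (ycurve q))" for s t
      unfolding I_def
      by (auto intro!: continuous_on_compose2[OF g_cont continuous_on_ycurve] continuous_on_compose2[OF H_cont continuous_on_ycurve])
    then show ?thesis
      unfolding DG_def I_def by (intro continuous_intros continuous_on_pcurve)
  qed
  have DG_inj: "w = 0" if "q \<in> I" "DG q w = 0" for q w
  proof -
    have "inner lam (snd w) = 0" using that(2) by (simp add: DG_def zero_prod_def)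
    moreover have "Lam s * snd w $ s = fst w * g s (ycurve q) + pcurve q * (\<Sum>t\<in>UNIV. H s t (ycurve q) * snd w $ t)" for s
    proof -
      have "snd (DG q w) $ s = 0" unfolding that(2) by simp
      then show ?thesis unfolding DG_def by simp
    qed
    ultimately have "fst w = 0 \<and> snd w = 0"
      by (rule linearized_injective[OF S[OF that(1)]])
    then show ?thesis by (simp add: prod_eq_iff)
  qed
  have G_c: "G (c q) = (0, \<chi> s. b s) + q *\<^sub>R (1, 0)" if "q \<in> I" for q
  proof -
    have "Lam s * ycurve q $ s - pcurve q * g s (ycurve q) = b s" for s
      using S[OF that] unfolding sol_def by (metis add_diff_cancel_left')
    moreover have "inner lam (ycurve q) = q" using sol_curve(2) that by (simp add: I_def)
    ultimately show ?thesis unfolding G_def c_def by simp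
  qed
  obtain c' where c': "continuous_on I c'"
    "\<And>q. q \<in> I \<Longrightarrow> (c has_vector_derivative c' q) (at q within I)"
    "\<And>q. q \<in> I \<Longrightarrow> DG q (c' q) = (1, 0)"
  proof (rule C1_curve_of_linear_image[of "level 0" "level 1" c G DG "(0, \<chi> s. b s)" "(1, 0)", folded I_def])
    fix c'
    assume "continuous_on I c'" "\<And>q. q \<in> I \<Longrightarrow> (c has_vector_derivative c' q) (at q within I)"
      "\<And>q. q \<in> I \<Longrightarrow> DG q (c' q) = (1, 0)"
    then show thesis by (rule that)
  qed (rule c G_deriv DG_cont DG_inj G_c; assumption)+
  define p' where "p' q = fst (c' q)" for q
  define y' where "y' q = snd (c' q)" for q
  have dp: "(pcurve has_real_derivative p' q) (at q within I)" if "q \<in> I" for q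
    using bounded_linear.has_vector_derivative[OF bounded_linear_fst c'(2)[OF that]]
    by (simp add: c_def p'_def has_real_derivative_iff_has_vector_derivative)
  have dy: "(ycurve has_vector_derivative y' q) (at q within I)" if "q \<in> I" for q
    using bounded_linear.has_vector_derivative[OF bounded_linear_snd c'(2)[OF that]]
    by (simp add: c_def y'_def)
  have lin: "inner lam (y' q) = 1"
    "Lam s * y' q $ s = p' q * g s (ycurve q) + pcurve q * (\<Sum>t\<in>UNIV. H s t (ycurve q) * y' q $ t)"
    if "q \<in> I" for q s
    using c'(3)[OF that] by (auto simp: DG_def p'_def y'_def vec_eq_iff)
  have p'0: "0 \<le> p' q" if "q \<in> I" for q
    using dp[OF that] that level_0_less_1 pcurve_le_iff unfolding I_def
    by (intro mono_on_deriv_within_nonneg[of "level 0" "level 1" pcurve]) (auto intro!: mono_onI)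
  have y'0: "0 \<le> y' q $ s" if "q \<in> I" for q s
  proof (rule mono_on_deriv_within_nonneg)
    show "((\<lambda>q. ycurve q $ s) has_real_derivative y' q $ s) (at q within {level 0..level 1})"
      using bounded_linear.has_vector_derivative[OF bounded_linear_vec_nth dy[OF that]]
      by (simp add: has_real_derivative_iff_has_vector_derivative I_def)
    show "mono_on {level 0..level 1} (\<lambda>q. ycurve q $ s)"
      using ycurve_mono by (intro mono_onI) (auto simp: less_eq_vec_def)
  qed (use that level_0_less_1 in \<open>auto simp: I_def\<close>)
  have y'pos: "0 < y' q $ s" if q: "q \<in> I" for q s
  proof -
    have p: "0 \<le> pcurve q" using S[OF q] by (simp add: sol_def)
    have gp: "0 < g s (ycurve q)" using sol_g_pos[OF S[OF q]] .
    have Hp: "0 < H s t (ycurve q)" for t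
      using S[OF q] by (intro H_pos sol_wide[OF S[OF q]]) (simp add: sol_def)
    obtain t where "y' q $ t \<noteq> 0"
      using lin(1)[OF q] by (metis inner_zero_right vec_eq_iff zero_index zero_neq_one)
    then have t: "0 < y' q $ t" using y'0[OF q, of t] by simp
    have "0 < Lam s * y' q $ s"
    proof (cases "pcurve q = 0")
      case True
      then have "0 < p' q"
      proof -
        have "0 < Lam t * y' q $ t" using Lam_pos t by (rule mult_pos_pos)
        then have "p' q \<noteq> 0" unfolding lin(2)[OF q, of t] using True by auto
        then show ?thesis using p'0[OF q] by simp
      qed
      then show ?thesis unfolding lin(2)[OF q, of s] using True gp by simp
    next
      case False
      have "0 < (\<Sum>t\<in>UNIV. H s t (ycurve q) * y' q $ t)"
        using Hp y'0[OF q] t by (intro sum_pos2[of _ t]) (auto intro!: mult_nonneg_nonneg intro: less_imp_le)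
      then have "0 < pcurve q * (\<Sum>t\<in>UNIV. H s t (ycurve q) * y' q $ t)" using p False by simp
      then show ?thesis
        unfolding lin(2)[OF q, of s] using p'0[OF q] gp by (intro add_nonneg_pos) auto
    qed
    then show ?thesis using Lam_pos[of s] by (simp add: zero_less_mult_iff)
  qed
  show thesis
  proof (rule that)
    show "continuous_on {level 0..level 1} p'" "continuous_on {level 0..level 1} y'"
      using c'(1) unfolding p'_def y'_def I_def by (auto intro: continuous_intros)
  qed (use dp dy lin p'0 y'pos in \<open>simp_all only: I_def\<close>)
qed

lemma Lam_x: "Lam s * x $ s = g s x + b s"
  using x_pos[of s] by (simp add: Lam_def)

lemma first_integral:
  assumes "\<And>r. r \<in> {\<alpha>..\<beta>} \<Longrightarrow> \<exists>d. ((\<lambda>r. p r * g s (\<Phi> r)) has_real_derivative Lam s * d) (at r within {\<alpha>..\<beta>})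
      \<and> ((\<lambda>r. \<Phi> r $ s) has_real_derivative d) (at r within {\<alpha>..\<beta>})"
    and "p \<beta> = 1" "\<Phi> \<beta> = x" "q \<in> {\<alpha>..\<beta>}"
  shows "Lam s * \<Phi> q $ s = p q * g s (\<Phi> q) + b s"
proof -
  define F where "F r = Lam s * \<Phi> r $ s - p r * g s (\<Phi> r)" for r
  have "(F has_field_derivative 0) (at r within {\<alpha>..\<beta>})" if r: "r \<in> {\<alpha>..\<beta>}" for r
  proof -
    obtain d where d: "((\<lambda>r. p r * g s (\<Phi> r)) has_real_derivative Lam s * d) (at r within {\<alpha>..\<beta>})"
      "((\<lambda>r. \<Phi> r $ s) has_real_derivative d) (at r within {\<alpha>..\<beta>})"
      using assms(1)[OF r] by blast
    show ?thesis
      using DERIV_diff[OF DERIV_cmult[OF d(2), of "Lam s"] d(1)] by (simp add: F_def[abs_def])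
  qed
  then obtain c where c: "\<And>r. r \<in> {\<alpha>..\<beta>} \<Longrightarrow> F r = c"
    using has_field_derivative_zero_constant[of "{\<alpha>..\<beta>}" F] by auto
  have "F q = F \<beta>" using c assms(4) by auto
  then show ?thesis using assms(2,3) Lam_x[of s] by (simp add: F_def)
qed

text \<open>
  Every backward solution of the differential system with \<open>p \<ge> 0\<close> stays on the solution curve. The
  equations are assumed only where \<open>\<Phi>\<close> is in the domain of \<open>\<xi>\<close>; elsewhere all that is needed is that \<open>p\<close>
  and \<open>p'\<close> do not vanish together.
\<close>

lemma backward_solution_on_curve:
  fixes p :: "real \<Rightarrow> real" and \<Phi> :: "real \<Rightarrow> real^'s"
  assumes \<alpha>: "\<alpha> < inner lam x" and ends: "p (inner lam x) = 1" "\<Phi> (inner lam x) = x"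
    and p_nonneg: "\<And>q. q \<in> {\<alpha>..inner lam x} \<Longrightarrow> 0 \<le> p q"
    and dp: "\<And>q. q \<in> {\<alpha>..inner lam x} \<Longrightarrow> (p has_real_derivative p' q) (at q within {\<alpha>..inner lam x})"
    and d\<Phi>: "\<And>q. q \<in> {\<alpha>..inner lam x} \<Longrightarrow> (\<Phi> has_vector_derivative v q) (at q within {\<alpha>..inner lam x})"
    and eq: "\<And>q s. q \<in> {\<alpha>..inner lam x} \<Longrightarrow> \<Phi> q \<in> wide_cube \<Longrightarrow>
        p' q * g s (\<Phi> q) + p q * (\<Sum>t\<in>UNIV. H s t (\<Phi> q) * v q $ t) = Lam s * v q $ s"
    and nondeg: "\<And>q. q \<in> {\<alpha>..inner lam x} \<Longrightarrow> \<not> (p q = 0 \<and> p' q = 0)"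
    and lv: "\<And>q. q \<in> {\<alpha>..inner lam x} \<Longrightarrow> inner lam (v q) = 1"
    and p'0: "\<And>q. q \<in> {\<alpha>..inner lam x} \<Longrightarrow> 0 \<le> p' q"
    and v0: "\<And>q s. q \<in> {\<alpha>..inner lam x} \<Longrightarrow> 0 \<le> v q $ s"
    and q: "q \<in> {\<alpha>..inner lam x}"
  shows "sol (p q) (\<Phi> q) \<and> inner lam (\<Phi> q) = q"
proof -
  define \<beta> where "\<beta> = inner lam x"
  note dp = dp[folded \<beta>_def] and d\<Phi> = d\<Phi>[folded \<beta>_def] and eq = eq[folded \<beta>_def]
    and nondeg = nondeg[folded \<beta>_def] and lv = lv[folded \<beta>_def]
    and p'0 = p'0[folded \<beta>_def] and v0 = v0[folded \<beta>_def]
  have p0: "0 \<le> p q" if "q \<in> {\<alpha>..\<beta>}" for q using p_nonneg that by (simp add: \<beta>_def)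
  have \<alpha>\<beta>: "\<alpha> < \<beta>" "\<beta> \<in> {\<alpha>..\<beta>}" using \<alpha> by (auto simp: \<beta>_def)
  have ends': "p \<beta> = 1" "\<Phi> \<beta> = x" using ends by (auto simp: \<beta>_def)
  have p_mono: "mono_on {\<alpha>..\<beta>} p"
    using dp p'0 by (rule deriv_within_nonneg_imp_mono_on)
  have \<Phi>_mono: "mono_on {\<alpha>..\<beta>} (\<lambda>q. \<Phi> q $ s)" for s
    using has_vector_derivative_nth[OF d\<Phi>] v0 by (rule deriv_within_nonneg_imp_mono_on)
  have \<Phi>_le_x: "\<Phi> q \<le> x" if "q \<in> {\<alpha>..\<beta>}" for q
    unfolding less_eq_vec_def using mono_onD[OF \<Phi>_mono that \<alpha>\<beta>(2)] that ends'(2) by simp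
  have \<Phi>_cont: "continuous_on {\<alpha>..\<beta>} \<Phi>"
    using d\<Phi> by (rule continuous_on_vector_derivative)
  have lin: "inner lam (\<Phi> q) = q" if "q \<in> {\<alpha>..\<beta>}" for q
  proof -
    have "((\<lambda>q. inner lam (\<Phi> q) - q) has_vector_derivative 0) (at r within {\<alpha>..\<beta>})" if "r \<in> {\<alpha>..\<beta>}" for r
    proof -
      have "((\<lambda>q. inner lam (\<Phi> q)) has_vector_derivative inner lam (v r)) (at r within {\<alpha>..\<beta>})"
        by (rule bounded_linear.has_vector_derivative[OF bounded_linear_inner_right d\<Phi>[OF that]])
      from has_vector_derivative_diff[OF this has_vector_derivative_id]
      show ?thesis using lv[OF that] by simp
    qed
    then obtain c where "\<And>r. r \<in> {\<alpha>..\<beta>} \<Longrightarrow> inner lam (\<Phi> r) - r = c"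
      using has_vector_derivative_zero_constant[of "{\<alpha>..\<beta>}" "\<lambda>q. inner lam (\<Phi> q) - q"] by auto
    from this[OF that] this[OF \<alpha>\<beta>(2)] show ?thesis using ends'(2) by (simp add: \<beta>_def)
  qed
  \<comment> \<open>on \<open>[c, \<beta>]\<close> the solution is in the domain of \<open>\<xi>\<close>, and the first integral holds\<close>
  define Z where "Z = {q \<in> {\<alpha>..\<beta>}. 0 \<le> \<Phi> q}"
  define c where "c = Inf Z"
  have Z_up: "r \<in> Z" if "q \<in> Z" "q \<le> r" "r \<le> \<beta>" for q r
  proof -
    have "q \<in> {\<alpha>..\<beta>}" "r \<in> {\<alpha>..\<beta>}" using that by (auto simp: Z_def)
    then have "\<Phi> q \<le> \<Phi> r"
      using mono_onD[OF \<Phi>_mono] that(2) by (simp add: less_eq_vec_def)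
    moreover have "0 \<le> \<Phi> q" using that(1) by (simp add: Z_def)
    ultimately show ?thesis
      using \<open>r \<in> {\<alpha>..\<beta>}\<close> unfolding Z_def by (blast intro: order_trans)
  qed
  have "\<beta> \<in> Z" using \<alpha>\<beta>(2) ends'(2) x_nonneg by (simp add: Z_def)
  have bdd: "bdd_below Z" by (rule bdd_belowI[of _ \<alpha>]) (simp add: Z_def)
  have "closed ({\<alpha>..\<beta>} \<inter> \<Phi> -` {0..})"
    by (rule continuous_closed_preimage[OF \<Phi>_cont]) (auto simp: closed_eucl_atLeast)
  moreover have "{\<alpha>..\<beta>} \<inter> \<Phi> -` {0..} = Z" by (auto simp: Z_def)
  ultimately have "c \<in> Z"
    unfolding c_def using \<open>\<beta> \<in> Z\<close> bdd by (intro closed_contains_Inf) auto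
  then have c: "\<alpha> \<le> c" "c \<le> \<beta>" by (auto simp: Z_def)
  have wide: "\<Phi> q \<in> wide_cube" if "q \<in> {c..\<beta>}" for q
    using Z_up[OF \<open>c \<in> Z\<close>, of q] \<Phi>_le_x[of q] that by (intro below_x_wide) (auto simp: Z_def)
  have on_curve: "sol (p q) (\<Phi> q)" if q: "q \<in> {c..\<beta>}" for q
  proof -
    have sub: "{c..\<beta>} \<subseteq> {\<alpha>..\<beta>}" using c by auto
    have qI: "q \<in> {\<alpha>..\<beta>}" using q sub by blast
    have "Lam s * \<Phi> q $ s = p q * g s (\<Phi> q) + b s" for s
    proof (rule first_integral[where p = p and \<Phi> = \<Phi> and \<beta> = \<beta>, OF _ ends' q])
      fix r assume r: "r \<in> {c..\<beta>}"
      then have rI: "r \<in> {\<alpha>..\<beta>}" using sub by blast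
      have "((\<lambda>r. p r * g s (\<Phi> r)) has_real_derivative Lam s * v r $ s) (at r within {c..\<beta>})"
        using deriv_along_curve[OF dp[OF rI] d\<Phi>[OF rI] wide[OF r], of s]
        unfolding eq[OF rI wide[OF r]] by (rule DERIV_subset[OF _ sub])
      moreover have "((\<lambda>r. \<Phi> r $ s) has_real_derivative v r $ s) (at r within {c..\<beta>})"
        using has_vector_derivative_nth[OF d\<Phi>[OF rI]] by (rule DERIV_subset[OF _ sub])
      ultimately show "\<exists>d. ((\<lambda>r. p r * g s (\<Phi> r)) has_real_derivative Lam s * d) (at r within {c..\<beta>})
        \<and> ((\<lambda>r. \<Phi> r $ s) has_real_derivative d) (at r within {c..\<beta>})" by blast
    qed
    moreover have "p q \<le> 1" using mono_onD[OF p_mono qI \<alpha>\<beta>(2)] qI ends'(1) by simp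
    moreover have "0 \<le> \<Phi> q" using Z_up[OF \<open>c \<in> Z\<close>, of q] q by (simp add: Z_def)
    ultimately show ?thesis
      using p0[OF qI] \<Phi>_le_x[OF qI] by (simp only: sol_def) blast
  qed
  have "c = \<alpha>"
  proof (rule ccontr)
    assume "c \<noteq> \<alpha>"
    then have "\<alpha> < c" using c by simp
    have cI: "c \<in> {\<alpha>..\<beta>}" using c by simp
    \<comment> \<open>otherwise \<open>p\<close> vanishes on \<open>[\<alpha>, c]\<close>, and so does its derivative at \<open>c\<close>\<close>
    have p_c: "p c \<noteq> 0"
    proof
      assume "p c = 0"
      have "p r = 0" if "r \<in> {\<alpha>..c}" for r
        using mono_onD[OF p_mono, of r c] p0[of r] that c \<open>p c = 0\<close> by auto
      then have "mono_on {\<alpha>..c} (\<lambda>r. - p r)" by (intro mono_onI) simp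
      moreover have "((\<lambda>r. - p r) has_real_derivative - p' c) (at c within {\<alpha>..c})"
        using c by (intro DERIV_minus DERIV_subset[OF dp[OF cI]]) auto
      ultimately have "0 \<le> - p' c"
        by (rule mono_on_deriv_within_nonneg) (use \<open>\<alpha> < c\<close> in auto)
      then show False using nondeg[OF cI] p'0[OF cI] \<open>p c = 0\<close> by simp
    qed
    have "0 < p c" using p_c p0[OF cI] by simp
    then have pos: "0 < \<Phi> c $ s" for s
      using on_curve[of c] c by (intro sol_pos) auto
    \<comment> \<open>strict positivity at \<open>c\<close> persists for slightly smaller times, contrary to the choice of \<open>c\<close>\<close>
    have "(\<Phi> \<longlongrightarrow> \<Phi> c) (at c within {\<alpha>..\<beta>})"
      using \<Phi>_cont cI by (simp add: continuous_on_def)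
    then have "\<forall>\<^sub>F r in at c within {\<alpha>..\<beta>}. \<forall>s\<in>UNIV. 0 < \<Phi> r $ s"
      using pos by (intro eventually_ball_finite ballI order_tendstoD(1)[OF tendsto_vec_nth]) auto
    then obtain d where d: "d > 0" "\<And>r. r \<in> {\<alpha>..\<beta>} \<Longrightarrow> r \<noteq> c \<Longrightarrow> dist r c < d \<Longrightarrow> \<forall>s. 0 < \<Phi> r $ s"
      unfolding eventually_at by auto
    define r where "r = max \<alpha> (c - d / 2)"
    have r: "r \<in> {\<alpha>..\<beta>}" "r < c" "dist r c < d"
      using \<open>\<alpha> < c\<close> c d(1) by (auto simp: r_def dist_real_def)
    then have "\<forall>s. 0 < \<Phi> r $ s" using d(2) by blast
    then have "r \<in> Z" using r(1) by (simp add: Z_def less_eq_vec_def less_imp_le)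
    then have "c \<le> r" unfolding c_def using bdd by (rule cInf_lower)
    then show False using r(2) by simp
  qed
  then show ?thesis using on_curve[of q] lin[of q] q by (simp add: \<beta>_def)
qed

end

section \<open>Super-solvable points near the origin\<close>

text \<open>
  The form is compared termwise with a diagonal one by the arithmetic-geometric mean inequality for \<open>v_s / w_s\<close>.
\<close>

lemma weighted_diagonal_dominance:
  fixes A :: "'s::finite \<Rightarrow> 's \<Rightarrow> real" and v :: "real^'s"
  assumes A: "\<And>s t. 0 \<le> A s t" and sym: "\<And>s t. A s t = A t s" and w: "\<And>s. 0 < w s"
    and dom: "\<And>s. (\<Sum>t\<in>UNIV. A s t * w t) \<le> d s * w s"
  shows "(\<Sum>s\<in>UNIV. \<Sum>t\<in>UNIV. v $ s * (A s t * v $ t)) \<le> (\<Sum>s\<in>UNIV. d s * (v $ s)\<^sup>2)"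
proof -
  define f where "f s t = A s t * w t / w s * (v $ s)\<^sup>2 / 2" for s t
  have "v $ s * (A s t * v $ t) \<le> f s t + f t s" for s t
  proof -
    define a where "a = v $ s / w s"
    define c where "c = v $ t / w t"
    have v: "v $ s = a * w s" "v $ t = c * w t" using w[of s] w[of t] by (auto simp: a_def c_def)
    have "A s t * w s * w t * (2 * (a * c)) \<le> A s t * w s * w t * (a\<^sup>2 + c\<^sup>2)"
      using A[of s t] w[of s] w[of t] sum_squares_bound[of a c]
      by (intro mult_left_mono) (auto simp: less_imp_le)
    then show ?thesis
      unfolding f_def v using w[of s] w[of t] sym[of t s]
      by (simp add: power_mult_distrib power2_eq_square algebra_simps)
  qed
  then have "(\<Sum>s\<in>UNIV. \<Sum>t\<in>UNIV. v $ s * (A s t * v $ t)) \<le> (\<Sum>s\<in>UNIV. \<Sum>t\<in>UNIV. f s t + f t s)"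
    by (intro sum_mono)
  also have "\<dots> = 2 * (\<Sum>s\<in>UNIV. \<Sum>t\<in>UNIV. f s t)"
    using sum.swap[of "\<lambda>s t. f t s" UNIV UNIV] by (simp add: sum.distrib)
  also have "\<dots> = (\<Sum>s\<in>UNIV. (\<Sum>t\<in>UNIV. A s t * w t) / w s * (v $ s)\<^sup>2)"
    by (simp add: f_def sum_distrib_left sum_distrib_right sum_divide_distrib)
  also have "\<dots> \<le> (\<Sum>s\<in>UNIV. d s * (v $ s)\<^sup>2)"
    using dom w by (intro sum_mono mult_right_mono) (auto simp: divide_le_eq)
  finally show ?thesis .
qed

text \<open>
  At the point \<open>(\<epsilon>, ..., \<epsilon>)\<close> the diagonal entries with \<open>b s > 0\<close> are of order \<open>1 / \<epsilon>\<close>, while for \<open>b s = 0\<close> they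
  tend to the row sum of the Hessian at 0, which is why these species receive the larger weight 2.
\<close>

lemma (in species_gradient) psd_near_origin:
  fixes b :: "'s \<Rightarrow> real"
  assumes b: "\<And>s. 0 \<le> b s" "0 < b s0"
  obtains \<epsilon> where "0 < \<epsilon>" "\<epsilon> \<le> 1"
    "\<And>v. (\<Sum>s\<in>UNIV. \<Sum>t\<in>UNIV. v $ s * (H s t (\<chi> s. \<epsilon>) * v $ t))
      \<le> (\<Sum>s\<in>UNIV. (g s (\<chi> s. \<epsilon>) + b s) / \<epsilon> * (v $ s)\<^sup>2)"
proof -
  define X where "X \<epsilon> = (\<chi> s::'s. \<epsilon>)" for \<epsilon> :: real
  define w where "w s = (if 0 < b s then 1 else 2 :: real)" for s
  have w: "0 < w s" "w s \<le> 2" for s by (auto simp: w_def)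
  have X: "0 \<le> X \<epsilon>" "X \<epsilon> \<in> wide_cube" "X \<epsilon> \<le> X 1" if "0 \<le> \<epsilon>" "\<epsilon> \<le> 1" for \<epsilon>
    using that by (auto simp: X_def less_eq_vec_def wide_cube_def)
  have X0: "X 0 = 0" by (simp add: X_def vec_eq_iff)
  have H0: "0 < H s t 0" for s t using H_pos[OF order_refl zero_wide] .
  have small: "\<forall>\<^sub>F \<epsilon> in at_right 0. 0 < \<epsilon> \<and> \<epsilon> \<le> (1::real)"
    by (auto simp: eventually_at_right_field intro!: exI[of _ 1])
  have dom: "\<forall>\<^sub>F \<epsilon> in at_right 0. (\<Sum>t\<in>UNIV. H s t (X \<epsilon>) * w t) \<le> (g s (X \<epsilon>) + b s) / \<epsilon> * w s" for s
  proof (cases "0 < b s")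
    case True
    define C where "C = (\<Sum>t\<in>UNIV. H s t (X 1) * 2)"
    have "filterlim (\<lambda>\<epsilon>::real. b s / \<epsilon>) at_top (at_right 0)"
      using filterlim_tendsto_pos_mult_at_top[OF tendsto_const True filterlim_inverse_at_top_right]
      by (simp add: divide_inverse)
    then have "\<forall>\<^sub>F \<epsilon> in at_right 0. C \<le> b s / \<epsilon>" by (simp add: filterlim_at_top)
    with small show ?thesis
    proof eventually_elim
      case (elim \<epsilon>)
      then have \<epsilon>: "0 < \<epsilon>" "0 \<le> \<epsilon>" "\<epsilon> \<le> 1" by auto
      have "(\<Sum>t\<in>UNIV. H s t (X \<epsilon>) * w t) \<le> C"
        unfolding C_def using w X[OF \<epsilon>(2,3)] X[of 1]
        by (intro sum_mono mult_mono H_mono less_imp_le[OF H_pos]) (auto intro: less_imp_le)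
      also have "\<dots> \<le> (g s (X \<epsilon>) + b s) / \<epsilon> * w s"
        using elim(2) divide_nonneg_pos[OF g_nonneg[OF X(1,2)[OF \<epsilon>(2,3)], of s] \<epsilon>(1)] True
        by (simp add: w_def add_divide_distrib)
      finally show ?case .
    qed
  next
    case False
    have cont: "((\<lambda>\<epsilon>. H s t (X \<epsilon>)) \<longlongrightarrow> H s t 0) (at_right 0)" for t
    proof -
      have "isCont (H s t) (X 0)"
        using continuous_on_eq_continuous_at[OF open_wide_cube, THEN iffD1, OF H_cont] zero_wide X0 by simp
      moreover have "(X \<longlongrightarrow> X 0) (at_right 0)" unfolding X_def by (intro tendsto_intros)
      ultimately show ?thesis unfolding X0[symmetric] by (rule isCont_tendsto_compose)
    qed
    have "((\<lambda>\<epsilon>. \<Sum>t\<in>UNIV. H s t (X \<epsilon>) * w t) \<longlongrightarrow> (\<Sum>t\<in>UNIV. H s t 0 * w t)) (at_right 0)"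
      by (intro tendsto_intros cont)
    moreover have "(\<Sum>t\<in>UNIV. H s t 0 * w t) < (\<Sum>t\<in>UNIV. H s t 0 * 2)"
    proof (rule sum_strict_mono_ex1)
      show "\<forall>t\<in>UNIV. H s t 0 * w t \<le> H s t 0 * 2"
        using w H0 by (auto intro!: mult_left_mono less_imp_le[OF H0])
      show "\<exists>t\<in>UNIV. H s t 0 * w t < H s t 0 * 2"
        using b(2) H0 by (intro bexI[of _ s0]) (auto simp: w_def)
    qed auto
    ultimately have "\<forall>\<^sub>F \<epsilon> in at_right 0. (\<Sum>t\<in>UNIV. H s t (X \<epsilon>) * w t) < (\<Sum>t\<in>UNIV. H s t 0 * 2)"
      by (rule order_tendstoD)
    with small show ?thesis
    proof eventually_elim
      case (elim \<epsilon>)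
      then have \<epsilon>: "0 < \<epsilon>" "0 \<le> \<epsilon>" "\<epsilon> \<le> 1" by auto
      have "(\<Sum>t\<in>UNIV. H s t 0 * (X \<epsilon> $ t - 0 $ t)) \<le> g s (X \<epsilon>) - g s 0"
        using X[OF \<epsilon>(2,3)] by (intro g_diff_ge) auto
      then have "\<epsilon> * (\<Sum>t\<in>UNIV. H s t 0) \<le> g s (X \<epsilon>)"
        by (simp add: X_def g_0 sum_distrib_left mult.commute)
      then have "(\<Sum>t\<in>UNIV. H s t 0) \<le> g s (X \<epsilon>) / \<epsilon>"
        using \<epsilon> by (simp add: le_divide_eq mult.commute)
      moreover have "b s = 0" using False b(1)[of s] by simp
      ultimately have "(\<Sum>t\<in>UNIV. H s t 0) * 2 \<le> (g s (X \<epsilon>) + b s) / \<epsilon> * 2"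
        by (intro mult_right_mono) simp_all
      then have "(\<Sum>t\<in>UNIV. H s t 0) * 2 \<le> (g s (X \<epsilon>) + b s) / \<epsilon> * w s"
        using False by (simp only: w_def if_False)
      then show ?case
        using elim(2) by (simp add: sum_distrib_right)
    qed
  qed
  have "\<forall>\<^sub>F \<epsilon> in at_right 0. (0 < \<epsilon> \<and> \<epsilon> \<le> 1) \<and>
      (\<forall>s\<in>UNIV. (\<Sum>t\<in>UNIV. H s t (X \<epsilon>) * w t) \<le> (g s (X \<epsilon>) + b s) / \<epsilon> * w s)"
    by (intro eventually_conj small eventually_ball_finite ballI dom) auto
  then obtain \<epsilon> where \<epsilon>: "0 < \<epsilon>" "\<epsilon> \<le> 1"
    "\<And>s. (\<Sum>t\<in>UNIV. H s t (X \<epsilon>) * w t) \<le> (g s (X \<epsilon>) + b s) / \<epsilon> * w s"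
    using eventually_happens[of _ "at_right (0::real)"] by (auto simp: trivial_limit_at_right_real)
  show thesis
  proof (rule that[OF \<epsilon>(1,2)])
    fix v :: "real^'s"
    show "(\<Sum>s\<in>UNIV. \<Sum>t\<in>UNIV. v $ s * (H s t (\<chi> s. \<epsilon>) * v $ t))
        \<le> (\<Sum>s\<in>UNIV. (g s (\<chi> s. \<epsilon>) + b s) / \<epsilon> * (v $ s)\<^sup>2)"
      unfolding X_def[symmetric]
      using X[of \<epsilon>] \<epsilon>(1,2) by (intro weighted_diagonal_dominance[OF _ H_sym[THEN fun_cong] w(1) \<epsilon>(3)] less_imp_le[OF H_pos]) auto
  qed
qed

section \<open>The mixture function of a model\<close>

text \<open>
  The coefficients of \<open>\<xi>\<close> as a power series in \<open>x\<close>; the values of \<open>\<Gamma>\<close> on words of length less than 2 are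
  discarded.
\<close>

definition xi_coeff :: "real^'s \<Rightarrow> ('s::finite list \<Rightarrow> real) \<Rightarrow> 's list \<Rightarrow> real" where
  "xi_coeff lam \<Gamma> ss = (if 2 \<le> length ss then (\<Gamma> ss)\<^sup>2 * (\<Prod>s\<leftarrow>ss. lam $ s) else 0)"

text \<open>
  The first and second partial derivatives of \<open>\<xi>\<close> on \<open>wide_cube\<close>.
\<close>

definition xi_grad :: "real^'s \<Rightarrow> ('s::finite list \<Rightarrow> real) \<Rightarrow> 's \<Rightarrow> real^'s \<Rightarrow> real" where
  "xi_grad lam \<Gamma> s = word_series (deriv_coeff s (xi_coeff lam \<Gamma>))"

definition xi_hess :: "real^'s \<Rightarrow> ('s::finite list \<Rightarrow> real) \<Rightarrow> 's \<Rightarrow> 's \<Rightarrow> real^'s \<Rightarrow> real" where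
  "xi_hess lam \<Gamma> s t = word_series (deriv_coeff t (deriv_coeff s (xi_coeff lam \<Gamma>)))"

lemma prod_list_pos: "(\<And>s. 0 < lam $ s) \<Longrightarrow> 0 < (\<Prod>s\<leftarrow>ss. lam $ s :: real)"
  by (induction ss) auto

lemma
  assumes "model lam h \<Gamma>"
  shows model_lam_pos: "0 < lam $ s" and model_lam_sum: "(\<Sum>s\<in>UNIV. lam $ s) = 1"
    and model_h_nonneg: "0 \<le> h $ s"
  using assms unfolding model_def by blast+

lemma xi_coeff_nonneg:
  assumes "model lam h \<Gamma>"
  shows "0 \<le> xi_coeff lam \<Gamma> ss"
  using prod_list_pos[OF model_lam_pos[OF assms], of ss] by (simp add: xi_coeff_def)

lemma perm_invariant_xi_coeff:
  assumes "model lam h \<Gamma>"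
  shows "perm_invariant (xi_coeff lam \<Gamma>)"
  unfolding perm_invariant_def
proof (intro allI impI)
  fix ss ts :: "'a list"
  assume eq: "mset ss = mset ts"
  have "(\<Prod>s\<leftarrow>ss. lam $ s) = (\<Prod>s\<leftarrow>ts. lam $ s)"
    by (simp flip: prod_mset_prod_list add: eq)
  moreover have "2 \<le> length ss \<Longrightarrow> \<Gamma> ss = \<Gamma> ts"
    using assms eq unfolding model_def by blast
  ultimately show "xi_coeff lam \<Gamma> ss = xi_coeff lam \<Gamma> ts"
    using mset_eq_length[OF eq] by (simp add: xi_coeff_def)
qed

lemma sum_prod_words: "(\<Sum>ss | length ss = k. \<Prod>s\<leftarrow>ss. lam $ s) = (\<Sum>s\<in>UNIV. lam $ s :: real) ^ k"
proof (induction k)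
  case (Suc k)
  then show ?case by (simp add: sum_words_Suc sum_distrib_left[symmetric] sum_distrib_right[symmetric])
qed (simp add: words_0[simplified])

text \<open>
  As the weights \<open>\<lambda>_s\<close> sum to 1, so do the products of weights over all words of length \<open>k\<close>.
\<close>

lemma coeff_mass_xi_le:
  fixes \<Gamma> :: "'s::finite list \<Rightarrow> real"
  assumes "model lam h \<Gamma>"
  shows "coeff_mass (xi_coeff lam \<Gamma>) k \<le> (tensor_sup_norm \<Gamma> k)\<^sup>2"
proof -
  note lam = model_lam_pos[OF assms] model_lam_sum[OF assms]
  have "coeff_mass (xi_coeff lam \<Gamma>) k \<le> (\<Sum>ss | length ss = k. (tensor_sup_norm \<Gamma> k)\<^sup>2 * (\<Prod>s\<leftarrow>ss. lam $ s))"
    unfolding coeff_mass_def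
  proof (rule sum_mono)
    fix ss :: "'s list"
    assume "ss \<in> {ss. length ss = k}"
    then have "\<bar>\<Gamma> ss\<bar> \<le> tensor_sup_norm \<Gamma> k"
      unfolding tensor_sup_norm_def by (intro Max_ge) auto
    then have "(\<Gamma> ss)\<^sup>2 \<le> (tensor_sup_norm \<Gamma> k)\<^sup>2" by (metis abs_ge_zero power2_abs power_mono)
    then show "\<bar>xi_coeff lam \<Gamma> ss\<bar> \<le> (tensor_sup_norm \<Gamma> k)\<^sup>2 * (\<Prod>s\<leftarrow>ss. lam $ s)"
      using prod_list_pos[OF lam(1), of ss]
      by (simp add: xi_coeff_def abs_mult mult_right_mono)
  qed
  also have "\<dots> = (tensor_sup_norm \<Gamma> k)\<^sup>2"
    by (simp add: sum_distrib_left[symmetric] sum_prod_words lam(2))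
  finally show ?thesis .
qed

lemma convergent_xi_coeff:
  fixes \<Gamma> :: "'s::finite list \<Rightarrow> real"
  assumes "model lam h \<Gamma>"
  shows "convergent_coeffs (xi_coeff lam \<Gamma>)"
  unfolding convergent_coeffs_def
proof (intro allI impI)
  fix \<rho> :: real
  assume \<rho>: "\<bar>\<rho>\<bar> < 2"
  define N where "N = tensor_sup_norm \<Gamma>"
  have N0: "0 \<le> N k" for k
  proof -
    have "0 \<le> \<bar>\<Gamma> (replicate k undefined)\<bar>" by simp
    also have "\<dots> \<le> N k" unfolding N_def tensor_sup_norm_def by (intro Max_ge) auto
    finally show ?thesis .
  qed
  have sm: "summable (\<lambda>k. 2 ^ k * N k)"
    using assms summable_iff_shift[of "\<lambda>k. 2 ^ k * N k" 2] unfolding model_def N_def by blast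
  then obtain K where K: "\<And>k. norm (2 ^ k * N k) \<le> K"
    using summable_imp_Bseq[OF sm] by (auto simp: Bseq_def)
  show "summable (\<lambda>k. coeff_mass (xi_coeff lam \<Gamma>) k * \<rho> ^ k)"
  proof (rule summable_comparison_test')
    show "summable (\<lambda>k. K * (2 ^ k * N k))" by (intro summable_mult sm)
    show "norm (coeff_mass (xi_coeff lam \<Gamma>) k * \<rho> ^ k) \<le> K * (2 ^ k * N k)" for k
    proof -
      have "norm (coeff_mass (xi_coeff lam \<Gamma>) k * \<rho> ^ k) = coeff_mass (xi_coeff lam \<Gamma>) k * \<bar>\<rho>\<bar> ^ k"
        by (simp add: abs_mult power_abs coeff_mass_nonneg)
      also have "\<dots> \<le> (N k)\<^sup>2 * 2 ^ k"
        using coeff_mass_xi_le[OF assms, of k] \<rho> unfolding N_def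
        by (intro mult_mono power_mono) auto
      also have "\<dots> = N k * (2 ^ k * N k)" by (simp add: power2_eq_square)
      also have "\<dots> \<le> K * (2 ^ k * N k)"
      proof (rule mult_right_mono)
        have "1 * N k \<le> 2 ^ k * N k" using N0 by (intro mult_right_mono) auto
        then show "N k \<le> K" using K[of k] by simp
      qed (simp add: N0)
      finally show ?thesis .
    qed
  qed
qed

lemma xi_eq_word_series:
  assumes "model lam h \<Gamma>" "y \<in> wide_cube"
  shows "xi lam \<Gamma> y = word_series (xi_coeff lam \<Gamma>) y"
proof -
  have prod: "(\<Prod>s\<leftarrow>ss. lam $ s * y $ s) = (\<Prod>s\<leftarrow>ss. lam $ s) * (\<Prod>s\<leftarrow>ss. y $ s)" for ss
    by (induction ss) (auto simp: mult_ac)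
  have "homog (xi_coeff lam \<Gamma>) (k + 2) y
      = (\<Sum>ss | length ss = k + 2. (\<Gamma> ss)\<^sup>2 * (\<Prod>s\<leftarrow>ss. lam $ s * y $ s))" for k
    unfolding homog_def prod by (intro sum.cong) (auto simp: xi_coeff_def mult_ac)
  then have "xi lam \<Gamma> y = (\<Sum>k. homog (xi_coeff lam \<Gamma>) (k + 2) y)"
    by (simp add: xi_def)
  moreover have "homog (xi_coeff lam \<Gamma>) 0 y = 0" "homog (xi_coeff lam \<Gamma>) (Suc 0) y = 0"
    by (simp_all add: homog_Suc xi_coeff_def)
  ultimately show ?thesis
    unfolding word_series_def
    using suminf_split_initial_segment[OF summable_homog[OF convergent_xi_coeff[OF assms(1)] assms(2)], of 2]
    by (simp add: numeral_2_eq_2 lessThan_Suc del: homog_0)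
qed

lemma species_gradient_xi:
  assumes "model lam h \<Gamma>" "nondegenerate \<Gamma>"
  shows "species_gradient (xi_grad lam \<Gamma>) (xi_hess lam \<Gamma>)"
proof -
  define C where "C = xi_coeff lam \<Gamma>"
  have inv: "perm_invariant C" and conv: "convergent_coeffs C"
    unfolding C_def using perm_invariant_xi_coeff convergent_xi_coeff assms(1) by blast+
  note inv' = inv perm_invariant_deriv_coeff and conv' = conv convergent_deriv_coeff
  have pos: "0 < C ss" if "length ss = 2 \<or> length ss = 3" for ss
  proof -
    have "0 < \<Gamma> ss" using that assms(2) unfolding nondegenerate_def by blast
    moreover have "0 < (\<Prod>s\<leftarrow>ss. lam $ s)" using model_lam_pos[OF assms(1)] by (rule prod_list_pos)
    ultimately show ?thesis using that by (auto simp: C_def xi_coeff_def)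
  qed
  have nonneg: "0 \<le> deriv_coeff t (deriv_coeff s C) ss" for s t ss
    using xi_coeff_nonneg[OF assms(1)] by (simp add: deriv_coeff_def C_def)
  have pos0: "0 < deriv_coeff t (deriv_coeff s C) []" and pos1: "0 < deriv_coeff t (deriv_coeff s C) [r]" for s t r
    using pos by (simp_all add: deriv_coeff_def)
  show ?thesis
    unfolding xi_grad_def xi_hess_def C_def[symmetric]
  proof
    fix y z :: "real^'a" and s t
    show "(word_series (deriv_coeff s C) has_derivative
        (\<lambda>v. \<Sum>t\<in>UNIV. word_series (deriv_coeff t (deriv_coeff s C)) y * v $ t)) (at y)"
      if "y \<in> wide_cube"
      using has_derivative_word_series[OF inv'(2) conv'(2) that, OF inv conv, of s]
      by (simp add: mult.commute)
    show "continuous_on wide_cube (word_series (deriv_coeff t (deriv_coeff s C)))"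
      by (intro continuous_on_word_series inv' conv')
    show "word_series (deriv_coeff t (deriv_coeff s C)) = word_series (deriv_coeff s (deriv_coeff t C))"
      using deriv_coeff_commute[OF inv] by metis
    show "0 < word_series (deriv_coeff t (deriv_coeff s C)) y" if "0 \<le> y" "y \<in> wide_cube"
      using that by (intro word_series_pos conv' nonneg pos0) (auto simp: less_eq_vec_def)
    show "word_series (deriv_coeff t (deriv_coeff s C)) y < word_series (deriv_coeff t (deriv_coeff s C)) z"
      if "0 \<le> y" "y \<le> z" "y \<noteq> z" "z \<in> wide_cube"
    proof -
      have "y \<in> wide_cube"
        unfolding wide_cube_def
      proof (intro CollectI allI)
        fix r
        have "0 \<le> y $ r" "y $ r \<le> z $ r" "\<bar>z $ r\<bar> < 2"
          using that by (auto simp: less_eq_vec_def wide_cube_def)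
        then show "\<bar>y $ r\<bar> < 2" by linarith
      qed
      then show ?thesis
        using that by (intro word_series_strict_mono conv' nonneg pos1) (auto simp: less_eq_vec_def)
    qed
    show "word_series (deriv_coeff s C) 0 = 0"
      by (simp add: word_series_zero deriv_coeff_def C_def xi_coeff_def)
  qed
qed

lemma partial_deriv_eq:
  assumes "(f has_derivative f') (at y)" "open U" "y \<in> U" "\<And>z. z \<in> U \<Longrightarrow> f z = F z"
  shows "partial_deriv s F y = f' (axis s 1)"
proof -
  have "(F has_derivative f') (at y)"
    using assms by (rule has_derivative_transform_within_open)
  moreover have "((\<lambda>t::real. y + t *\<^sub>R axis s 1) has_derivative (\<lambda>t. t *\<^sub>R axis s 1)) (at 0)"
    by (auto intro!: derivative_eq_intros)
  ultimately have "((\<lambda>t. F (y + t *\<^sub>R axis s 1)) has_derivative (\<lambda>t. f' (t *\<^sub>R axis s 1))) (at 0)"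
    using diff_chain_at[of "\<lambda>t::real. y + t *\<^sub>R axis s 1" "\<lambda>t. t *\<^sub>R axis s 1" 0 F f'] by (simp add: o_def)
  moreover have "f' (t *\<^sub>R axis s 1) = t * f' (axis s 1)" for t
    using has_derivative_linear[OF assms(1)] by (simp add: linear_scale)
  ultimately have "((\<lambda>t. F (y + t *\<^sub>R axis s 1)) has_real_derivative f' (axis s 1)) (at 0)"
    by (simp add: has_field_derivative_def mult_commute_abs)
  then show ?thesis
    unfolding partial_deriv_def by (rule DERIV_imp_deriv)
qed

lemma
  assumes "model lam h \<Gamma>" and y: "y \<in> wide_cube"
  shows partial_deriv_xi: "partial_deriv s (xi lam \<Gamma>) y = xi_grad lam \<Gamma> s y"
    and xi_species_eq: "xi_species lam \<Gamma> s y = xi_grad lam \<Gamma> s y / lam $ s"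
proof -
  have "partial_deriv s (xi lam \<Gamma>) y
      = (\<Sum>t\<in>UNIV. axis s 1 $ t * word_series (deriv_coeff t (xi_coeff lam \<Gamma>)) y)"
    using xi_eq_word_series[OF assms(1)]
    by (intro partial_deriv_eq[OF has_derivative_word_series open_wide_cube y] y
        perm_invariant_xi_coeff convergent_xi_coeff) (use assms in auto)
  also have "\<dots> = xi_grad lam \<Gamma> s y"
    by (simp add: xi_grad_def axis_def if_distrib[of "\<lambda>c. c * _"] cong: if_cong)
  finally show "partial_deriv s (xi lam \<Gamma>) y = xi_grad lam \<Gamma> s y" .
  then show "xi_species lam \<Gamma> s y = xi_grad lam \<Gamma> s y / lam $ s"
    by (simp add: xi_species_def)
qed

lemma
  assumes "model lam h \<Gamma>" "nondegenerate \<Gamma>" and y: "y \<in> wide_cube"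
  shows partial_deriv_partial_deriv_xi:
      "partial_deriv t (partial_deriv s (xi lam \<Gamma>)) y = xi_hess lam \<Gamma> s t y"
    and partial_deriv_xi_species:
      "partial_deriv t (xi_species lam \<Gamma> s) y = xi_hess lam \<Gamma> s t y / lam $ s"
proof -
  interpret species_gradient "xi_grad lam \<Gamma>" "xi_hess lam \<Gamma>"
    using assms(1,2) by (rule species_gradient_xi)
  have ax: "(\<Sum>r\<in>UNIV. c r * axis t 1 $ r) = c t" for c :: "'a \<Rightarrow> real"
    by (simp add: axis_def if_distrib[of "\<lambda>d. _ * d"] cong: if_cong)
  have "partial_deriv t (partial_deriv s (xi lam \<Gamma>)) y = (\<Sum>r\<in>UNIV. xi_hess lam \<Gamma> s r y * axis t 1 $ r)"
    using partial_deriv_xi[OF assms(1)] by (intro partial_deriv_eq[OF g_deriv[OF y] open_wide_cube y]) simp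
  then show "partial_deriv t (partial_deriv s (xi lam \<Gamma>)) y = xi_hess lam \<Gamma> s t y"
    by (simp add: ax)
  have "((\<lambda>y. xi_grad lam \<Gamma> s y / lam $ s) has_derivative
      (\<lambda>v. (\<Sum>r\<in>UNIV. xi_hess lam \<Gamma> s r y * v $ r) / lam $ s)) (at y)"
    using has_derivative_mult_left[OF g_deriv[OF y, of s], of "inverse (lam $ s)"]
    by (simp add: divide_inverse)
  then have "partial_deriv t (xi_species lam \<Gamma> s) y = (\<Sum>r\<in>UNIV. xi_hess lam \<Gamma> s r y * axis t 1 $ r) / lam $ s"
    using xi_species_eq[OF assms(1)] by (intro partial_deriv_eq[OF _ open_wide_cube y]) auto
  then show "partial_deriv t (xi_species lam \<Gamma> s) y = xi_hess lam \<Gamma> s t y / lam $ s"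
    by (simp add: ax)
qed

lemma positive_semidefinite_M_sym_iff:
  assumes "model lam h \<Gamma>" "nondegenerate \<Gamma>" and x: "x \<in> wide_cube"
  shows "positive_semidefinite (M_sym lam h \<Gamma> x) \<longleftrightarrow>
    (\<forall>v. (\<Sum>s\<in>UNIV. \<Sum>t\<in>UNIV. v $ s * (xi_hess lam \<Gamma> s t x * v $ t))
       \<le> (\<Sum>s\<in>UNIV. (xi_grad lam \<Gamma> s x + lam $ s * (h $ s)\<^sup>2) / x $ s * (v $ s)\<^sup>2))"
proof -
  interpret species_gradient "xi_grad lam \<Gamma>" "xi_hess lam \<Gamma>"
    using assms(1,2) by (rule species_gradient_xi)
  define d where "d s = (xi_grad lam \<Gamma> s x + lam $ s * (h $ s)\<^sup>2) / x $ s" for s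
  have M: "M_sym lam h \<Gamma> x $ s $ t = (if s = t then d s else 0) - xi_hess lam \<Gamma> s t x" for s t
    unfolding M_sym_def d_def
    using partial_deriv_partial_deriv_xi[OF assms, of s t] partial_deriv_xi[OF assms(1) x] H_sym[of s t]
    by simp
  have "transpose (M_sym lam h \<Gamma> x) = M_sym lam h \<Gamma> x"
    using H_sym by (auto simp: transpose_def vec_eq_iff M)
  moreover have "v \<bullet> (M_sym lam h \<Gamma> x *v v) = (\<Sum>s\<in>UNIV. d s * (v $ s)\<^sup>2)
      - (\<Sum>s\<in>UNIV. \<Sum>t\<in>UNIV. v $ s * (xi_hess lam \<Gamma> s t x * v $ t))" for v
  proof -
    have "v $ s * (\<Sum>t\<in>UNIV. M_sym lam h \<Gamma> x $ s $ t * v $ t)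
        = d s * (v $ s)\<^sup>2 - (\<Sum>t\<in>UNIV. v $ s * (xi_hess lam \<Gamma> s t x * v $ t))" for s
    proof -
      have "(\<Sum>t\<in>UNIV. M_sym lam h \<Gamma> x $ s $ t * v $ t)
          = d s * v $ s - (\<Sum>t\<in>UNIV. xi_hess lam \<Gamma> s t x * v $ t)"
        by (simp add: M left_diff_distrib sum_subtractf if_distrib[of "\<lambda>c. c * _"] cong: if_cong)
      then show ?thesis
        by (simp add: right_diff_distrib sum_distrib_left power2_eq_square mult_ac)
    qed
    then show ?thesis
      by (simp add: inner_vec_def matrix_vector_mult_def sum_subtractf)
  qed
  ultimately show ?thesis
    unfolding positive_semidefinite_def d_def by simp
qed

section \<open>Root-finding trajectories\<close>

theorem proposition1p5:
  fixes lam h :: "real^'s::finite" and \<Gamma> :: "'s list \<Rightarrow> real"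
  assumes "model lam h \<Gamma>" and "nondegenerate \<Gamma>"
  shows "(h \<noteq> 0 \<longleftrightarrow> (\<exists>x. super_solvable lam h \<Gamma> x)) \<and>
    (\<forall>x. super_solvable lam h \<Gamma> x \<longrightarrow>
      0 < lam \<bullet> x \<and>
      (\<exists>q0 p \<Phi>.
        root_finding_trajectory lam h \<Gamma> x q0 p \<Phi> \<and>
        (\<forall>q0' p2 \<Phi>2. root_finding_trajectory lam h \<Gamma> x q0' p2 \<Phi>2 \<longrightarrow>
           q0' = q0 \<and> (\<forall>q\<in>{q0..lam \<bullet> x}. p2 q = p q \<and> \<Phi>2 q = \<Phi> q)) \<and>
        obtained_by_backward_solving lam h \<Gamma> x q0 p \<Phi> \<and>
        mono_on {q0..lam \<bullet> x} p \<and> concave_on {q0..lam \<bullet> x} p \<and>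
        0 < q0 \<and> (\<forall>s. 0 < \<Phi> q0 $ s \<longleftrightarrow> 0 < h $ s)))"
proof -
  note lam_pos' = model_lam_pos[OF assms(1)] and h_nonneg = model_h_nonneg[OF assms(1)]
  define G where "G = xi_grad lam \<Gamma>"
  define HH where "HH = xi_hess lam \<Gamma>"
  define b where "b s = lam $ s * (h $ s)\<^sup>2" for s
  interpret sg: species_gradient G HH
    unfolding G_def HH_def using assms by (rule species_gradient_xi)
  have b0: "0 \<le> b s" for s using lam_pos'[of s] by (simp add: b_def)
  have b_pos: "0 < b s \<longleftrightarrow> 0 < h $ s" for s
    using lam_pos'[of s] h_nonneg[of s] by (auto simp: b_def zero_less_mult_iff order_less_le)
  have psd: "super_solvable_point G HH lam b x" if "super_solvable lam h \<Gamma> x" for x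
  proof
    show "0 < lam $ s" "0 \<le> b s" for s by (fact lam_pos' b0)+
    have xc: "0 < x $ s" "x $ s \<le> 1" for s
      using that by (auto simp: super_solvable_def half_open_cube_def)
    then show "0 < x $ s" "x $ s \<le> 1" for s by auto
    have "x \<in> wide_cube"
      unfolding wide_cube_def
    proof (intro CollectI allI)
      fix s
      show "\<bar>x $ s\<bar> < 2" using xc[of s] by simp
    qed
    then show "(\<Sum>s\<in>UNIV. \<Sum>t\<in>UNIV. v $ s * (HH s t x * v $ t))
        \<le> (\<Sum>s\<in>UNIV. (G s x + b s) / x $ s * (v $ s)\<^sup>2)" for v
      using that positive_semidefinite_M_sym_iff[OF assms]
      by (simp add: super_solvable_def G_def HH_def b_def)
  qed
  have h_iff: "h \<noteq> 0 \<longleftrightarrow> (\<exists>x. super_solvable lam h \<Gamma> x)"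
  proof
    assume "h \<noteq> 0"
    then obtain s0 where "h $ s0 \<noteq> 0" by (auto simp: vec_eq_iff)
    then have "0 < b s0" using b_pos[of s0] h_nonneg[of s0] by simp
    then obtain \<epsilon> where \<epsilon>: "0 < \<epsilon>" "\<epsilon> \<le> 1"
      "\<And>v. (\<Sum>s\<in>UNIV. \<Sum>t\<in>UNIV. v $ s * (HH s t (\<chi> s. \<epsilon>) * v $ t))
        \<le> (\<Sum>s\<in>UNIV. (G s (\<chi> s. \<epsilon>) + b s) / \<epsilon> * (v $ s)\<^sup>2)"
      using sg.psd_near_origin[of b s0] b0 by blast
    have "(\<chi> s::'s. \<epsilon>) \<in> wide_cube" using \<epsilon>(1,2) by (simp add: wide_cube_def)
    then have "super_solvable lam h \<Gamma> (\<chi> s. \<epsilon>)"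
      using positive_semidefinite_M_sym_iff[OF assms] \<epsilon>
      by (simp add: super_solvable_def half_open_cube_def G_def HH_def b_def)
    then show "\<exists>x. super_solvable lam h \<Gamma> x" ..
  next
    assume "\<exists>x. super_solvable lam h \<Gamma> x"
    then obtain x where "super_solvable lam h \<Gamma> x" ..
    then interpret super_solvable_point G HH lam b x by (rule psd)
    obtain s where "0 < b s" using b_pos_ex by blast
    then show "h \<noteq> 0" using b_pos[of s] by auto
  qed
  have "0 < lam \<bullet> x \<and>
      (\<exists>q0 p \<Phi>.
        root_finding_trajectory lam h \<Gamma> x q0 p \<Phi> \<and>
        (\<forall>q0' p2 \<Phi>2. root_finding_trajectory lam h \<Gamma> x q0' p2 \<Phi>2 \<longrightarrow>
           q0' = q0 \<and> (\<forall>q\<in>{q0..lam \<bullet> x}. p2 q = p q \<and> \<Phi>2 q = \<Phi> q)) \<and>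
        obtained_by_backward_solving lam h \<Gamma> x q0 p \<Phi> \<and>
        mono_on {q0..lam \<bullet> x} p \<and> concave_on {q0..lam \<bullet> x} p \<and>
        0 < q0 \<and> (\<forall>s. 0 < \<Phi> q0 $ s \<longleftrightarrow> 0 < h $ s))"
    if ss: "super_solvable lam h \<Gamma> x" for x
  proof -
    interpret super_solvable_point G HH lam b x using ss by (rule psd)
    define q0 where "q0 = level 0"
    define q1 where "q1 = lam \<bullet> x"
    have q1: "level 1 = q1" by (simp add: q1_def level_1)
    have q01: "q0 < q1" using level_0_less_1 by (simp add: q0_def q1)
    have spec: "xi_species lam \<Gamma> s y = G s y / lam $ s" if "y \<in> wide_cube" for s y
      using xi_species_eq[OF assms(1) that] by (simp add: G_def)
    have spec': "partial_deriv t (xi_species lam \<Gamma> s) y = HH s t y / lam $ s" if "y \<in> wide_cube" for s t y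
      using partial_deriv_xi_species[OF assms that] by (simp add: HH_def)
    have L: "L_coeff lam h \<Gamma> x s = Lam s / lam $ s" for s
      unfolding L_coeff_def Lam_def spec[OF x_wide] b_def
      using lam_pos'[of s] by (simp add: field_simps)
    \<comment> \<open>the differential system, multiplied by \<open>\<lambda>_s\<close>\<close>
    have L_ode: "p' * xi_species lam \<Gamma> s y + r * (\<Sum>t\<in>UNIV. partial_deriv t (xi_species lam \<Gamma> s) y * v $ t)
          = L_coeff lam h \<Gamma> x s * v $ s \<longleftrightarrow>
        p' * G s y + r * (\<Sum>t\<in>UNIV. HH s t y * v $ t) = Lam s * v $ s"
      if "y \<in> wide_cube" for p' r s y and v :: "real^'s"
    proof -
      have "p' * xi_species lam \<Gamma> s y + r * (\<Sum>t\<in>UNIV. partial_deriv t (xi_species lam \<Gamma> s) y * v $ t)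
          = (p' * G s y + r * (\<Sum>t\<in>UNIV. HH s t y * v $ t)) / lam $ s"
        unfolding spec[OF that] spec'[OF that]
        by (simp add: add_divide_distrib sum_divide_distrib[symmetric])
      then show ?thesis
        unfolding L using lam_pos'[of s] by (simp add: field_simps)
    qed
    obtain p' y' where C1: "continuous_on {q0..q1} p'" "continuous_on {q0..q1} y'"
      and dp: "\<And>q. q \<in> {q0..q1} \<Longrightarrow> (pcurve has_real_derivative p' q) (at q within {q0..q1})"
      and dy: "\<And>q. q \<in> {q0..q1} \<Longrightarrow> (ycurve has_vector_derivative y' q) (at q within {q0..q1})"
      and ode: "\<And>q s. q \<in> {q0..q1} \<Longrightarrow>
         Lam s * y' q $ s = p' q * G s (ycurve q) + pcurve q * (\<Sum>t\<in>UNIV. HH s t (ycurve q) * y' q $ t)"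
      and ly': "\<And>q. q \<in> {q0..q1} \<Longrightarrow> lam \<bullet> y' q = 1"
      and p'0: "\<And>q. q \<in> {q0..q1} \<Longrightarrow> 0 \<le> p' q"
      and y'0: "\<And>q s. q \<in> {q0..q1} \<Longrightarrow> 0 < y' q $ s"
      by (rule curve_C1[folded q0_def, unfolded q1]) (rule that)
    have S: "sol (pcurve q) (ycurve q)" "lam \<bullet> ycurve q = q" if "q \<in> {q0..q1}" for q
      using sol_curve that unfolding q0_def q1[symmetric] by auto
    have S_wide: "ycurve q \<in> wide_cube" if "q \<in> {q0..q1}" for q using sol_wide[OF S(1)[OF that]] .
    have S_bd: "0 \<le> ycurve q $ s" "ycurve q $ s \<le> 1" "0 \<le> pcurve q" "pcurve q \<le> 1"
      if "q \<in> {q0..q1}" for q s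
      using S(1)[OF that] x_le_1[of s] unfolding sol_def less_eq_vec_def by (auto intro: order_trans)
    have uniq: "q \<in> {q0..q1} \<and> r = pcurve q \<and> y = ycurve q" if "sol r y \<and> lam \<bullet> y = q" for q r y
      using sol_on_curve[of r y] that unfolding q0_def q1[symmetric] by blast
    have ends: "pcurve q0 = 0" "pcurve q1 = 1" "ycurve q1 = x"
      using pcurve_ends ycurve_end by (auto simp: q0_def q1)
    have y_q0: "Lam s * ycurve q0 $ s = b s" for s
      using S(1)[of q0] q01 ends(1) by (simp add: sol_def)
    have y_q0_pos: "0 < ycurve q0 $ s \<longleftrightarrow> 0 < h $ s" for s
      using y_q0[of s] b_pos[of s] Lam_pos[of s] by (metis mult_pos_pos zero_less_mult_pos)
    have q0_pos: "0 < q0"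
    proof -
      have "0 \<le> ycurve q0" using S_bd(1)[of q0] q01 by (simp add: less_eq_vec_def)
      moreover have "0 \<noteq> ycurve q0" using sol_nonzero[OF S(1)[of q0]] q01 by auto
      ultimately have "0 < lam \<bullet> ycurve q0" using inner_lam_strict_mono by force
      then show ?thesis using S(2)[of q0] q01 by simp
    qed
    have mono_p: "mono_on {q0..q1} pcurve"
      using pcurve_le_iff unfolding q0_def q1[symmetric] by (auto intro: mono_onI)
    have conc: "concave_on {q0..q1} pcurve"
      using concave_on_pcurve unfolding q0_def q1[symmetric] .
    have nth_d: "((\<lambda>q. ycurve q $ s) has_real_derivative y' q $ s) (at q within {q0..q1})" if "q \<in> {q0..q1}" for q s
      using has_vector_derivative_nth[OF dy[OF that]] .
    have traj: "root_finding_trajectory lam h \<Gamma> x q0 pcurve ycurve"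
      unfolding root_finding_trajectory_def Let_def q1_def[symmetric]
    proof (intro conjI ballI allI)
      show "0 \<le> q0" "q0 \<le> q1" using q0_pos q01 by auto
      show "pcurve \<in> incr_C1 q0 q1"
        unfolding incr_C1_def C1_on_interval_def using S_bd(3,4) mono_p dp C1(1)
        by (auto intro!: exI[of _ p'])
      show "ycurve \<in> Adm lam q0 q1"
        unfolding Adm_def incr_C1_def C1_on_interval_def
      proof (intro CollectI conjI allI ballI)
        fix s
        show "(\<lambda>q. ycurve q $ s) ` {q0..q1} \<subseteq> {0..1}" using S_bd(1,2) by auto
        show "mono_on {q0..q1} (\<lambda>q. ycurve q $ s)"
          using ycurve_mono unfolding q0_def q1[symmetric]
          by (intro mono_onI) (simp add: less_eq_vec_def)
        show "\<exists>f'. (\<forall>q\<in>{q0..q1}. ((\<lambda>q. ycurve q $ s) has_real_derivative f' q) (at q within {q0..q1}))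
            \<and> continuous_on {q0..q1} f'"
          using nth_d C1(2) by (intro exI[of _ "\<lambda>q. y' q $ s"]) (auto intro: continuous_intros)
      qed (use S(2) in auto)
      show "pcurve q1 = 1" "ycurve q1 = x" "pcurve q0 = 0" by (fact ends)+
      fix q s assume q: "q \<in> {q0..q1}"
      have v: "vector_derivative (\<lambda>u. ycurve u $ s) (at q within {q0..q1}) = y' q $ s"
        using nth_d[OF q] unfolding has_real_derivative_iff_has_vector_derivative
        by (rule vector_derivative_within_closed_interval[OF q01 q])
      show "vector_derivative (\<lambda>u. ycurve u $ s) (at q within {q0..q1}) \<noteq> 0"
        using v y'0[OF q, of s] by simp
      \<comment> \<open>the numerator is differentiated through the first integral\<close>
      have "((\<lambda>u. (Lam s * ycurve u $ s - b s) / lam $ s) has_real_derivative (Lam s * y' q $ s) / lam $ s)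
          (at q within {q0..q1})"
        using nth_d[OF q, of s] lam_pos'[of s] by (auto intro!: derivative_eq_intros)
      then have "((\<lambda>u. pcurve u * xi_species lam \<Gamma> s (ycurve u)) has_vector_derivative (Lam s * y' q $ s) / lam $ s)
          (at q within {q0..q1})"
        unfolding has_real_derivative_iff_has_vector_derivative
      proof (rule has_vector_derivative_transform[OF q, rotated])
        fix u assume u: "u \<in> {q0..q1}"
        have "Lam s * ycurve u $ s - b s = pcurve u * G s (ycurve u)"
          using S(1)[OF u] by (simp add: sol_def)
        then show "pcurve u * xi_species lam \<Gamma> s (ycurve u) = (Lam s * ycurve u $ s - b s) / lam $ s"
          using spec[OF S_wide[OF u]] by simp
      qed
      then have "vector_derivative (\<lambda>u. pcurve u * xi_species lam \<Gamma> s (ycurve u)) (at q within {q0..q1})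
          = (Lam s * y' q $ s) / lam $ s"
        by (rule vector_derivative_within_closed_interval[OF q01 q])
      then show "vector_derivative (\<lambda>u. pcurve u * xi_species lam \<Gamma> s (ycurve u)) (at q within {q0..q1}) /
          vector_derivative (\<lambda>u. ycurve u $ s) (at q within {q0..q1}) = L_coeff lam h \<Gamma> x s"
        using v y'0[OF q, of s] L[of s] by simp
    qed
    have traj_unique: "q0' = q0 \<and> (\<forall>q\<in>{q0..q1}. p2 q = pcurve q \<and> \<Phi>2 q = ycurve q)"
      if T: "root_finding_trajectory lam h \<Gamma> x q0' p2 \<Phi>2" for q0' p2 \<Phi>2
    proof -
      have r: "q0' \<le> q1" "p2 \<in> incr_C1 q0' q1" "\<Phi>2 \<in> Adm lam q0' q1"
        and e: "p2 q1 = 1" "\<Phi>2 q1 = x" "p2 q0' = 0"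
        and quot: "\<And>q s. q \<in> {q0'..q1} \<Longrightarrow>
           vector_derivative (\<lambda>u. \<Phi>2 u $ s) (at q within {q0'..q1}) \<noteq> 0 \<and>
           vector_derivative (\<lambda>u. p2 u * xi_species lam \<Gamma> s (\<Phi>2 u)) (at q within {q0'..q1})
             / vector_derivative (\<lambda>u. \<Phi>2 u $ s) (at q within {q0'..q1}) = L_coeff lam h \<Gamma> x s"
        using T unfolding root_finding_trajectory_def Let_def q1_def by blast+
      \<comment> \<open>\<open>p2\<close> takes different values at the endpoints\<close>
      have lt: "q0' < q1" using r(1) e by (cases "q0' = q1") auto
      obtain r' where r': "\<And>q. q \<in> {q0'..q1} \<Longrightarrow> (p2 has_real_derivative r' q) (at q within {q0'..q1})"
        using r(2) unfolding incr_C1_def C1_on_interval_def by blast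
      have "\<forall>s. \<exists>f'. \<forall>q\<in>{q0'..q1}. ((\<lambda>q. \<Phi>2 q $ s) has_real_derivative f' q) (at q within {q0'..q1})"
        using r(3) unfolding Adm_def incr_C1_def C1_on_interval_def by blast
      then obtain f' where f': "\<And>s q. q \<in> {q0'..q1} \<Longrightarrow> ((\<lambda>q. \<Phi>2 q $ s) has_real_derivative f' s q) (at q within {q0'..q1})"
        by metis
      have d\<Phi>: "(\<Phi>2 has_vector_derivative (\<chi> s. f' s q)) (at q within {q0'..q1})" if "q \<in> {q0'..q1}" for q
        unfolding has_vector_derivative_def
        using f'[OF that] by (intro has_derivative_vecI) (simp add: has_field_derivative_def mult_commute_abs)
      have bd: "0 \<le> p2 q" "p2 q \<le> 1" "0 \<le> \<Phi>2 q" "\<Phi>2 q \<le> x" "lam \<bullet> \<Phi>2 q = q" if q: "q \<in> {q0'..q1}" for q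
      proof -
        show "0 \<le> p2 q" "p2 q \<le> 1" using r(2) q by (auto simp: incr_C1_def image_subset_iff)
        show "0 \<le> \<Phi>2 q" using r(3) q by (auto simp: Adm_def incr_C1_def less_eq_vec_def image_subset_iff)
        show "\<Phi>2 q \<le> x"
          unfolding less_eq_vec_def e(2)[symmetric]
        proof
          fix s
          have "mono_on {q0'..q1} (\<lambda>q. \<Phi>2 q $ s)" using r(3) by (simp add: Adm_def incr_C1_def)
          then show "\<Phi>2 q $ s \<le> \<Phi>2 q1 $ s" by (rule mono_onD) (use q in auto)
        qed
        show "lam \<bullet> \<Phi>2 q = q" using r(3) q by (simp add: Adm_def)
      qed
      have wide: "\<Phi>2 q \<in> wide_cube" if "q \<in> {q0'..q1}" for q
        using below_x_wide bd(3,4)[OF that] by blast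
      have "Lam s * \<Phi>2 q $ s = p2 q * G s (\<Phi>2 q) + b s" if q: "q \<in> {q0'..q1}" for q s
      proof (rule first_integral[where p = p2 and \<Phi> = \<Phi>2 and \<beta> = q1, OF _ e(1,2) q])
        fix u assume u: "u \<in> {q0'..q1}"
        define d where "d = r' u * G s (\<Phi>2 u) + p2 u * (\<Sum>t\<in>UNIV. HH s t (\<Phi>2 u) * (\<chi> s. f' s u) $ t)"
        have d: "((\<lambda>u. p2 u * G s (\<Phi>2 u)) has_real_derivative d) (at u within {q0'..q1})"
          unfolding d_def by (rule sg.deriv_along_curve[OF r'[OF u] d\<Phi>[OF u] wide[OF u]])
        then have "((\<lambda>u. p2 u * G s (\<Phi>2 u) / lam $ s) has_real_derivative d / lam $ s) (at u within {q0'..q1})"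
          by (rule DERIV_cdivide)
        then have "((\<lambda>u. p2 u * xi_species lam \<Gamma> s (\<Phi>2 u)) has_vector_derivative d / lam $ s) (at u within {q0'..q1})"
          unfolding has_real_derivative_iff_has_vector_derivative
          by (rule has_vector_derivative_transform[OF u, rotated]) (simp add: spec wide)
        then have "vector_derivative (\<lambda>u. p2 u * xi_species lam \<Gamma> s (\<Phi>2 u)) (at u within {q0'..q1}) = d / lam $ s"
          by (rule vector_derivative_within_closed_interval[OF lt u])
        moreover have "vector_derivative (\<lambda>u. \<Phi>2 u $ s) (at u within {q0'..q1}) = f' s u"
          using f'[OF u, of s] unfolding has_real_derivative_iff_has_vector_derivative
          by (rule vector_derivative_within_closed_interval[OF lt u])
        ultimately have "f' s u \<noteq> 0" "d / lam $ s / f' s u = Lam s / lam $ s"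
          using quot[OF u, of s] L[of s] by auto
        then have "d = Lam s * f' s u"
          using lam_pos'[of s] by (simp add: field_simps)
        then show "\<exists>d. ((\<lambda>r. p2 r * G s (\<Phi>2 r)) has_real_derivative Lam s * d) (at u within {q0'..q1})
            \<and> ((\<lambda>r. \<Phi>2 r $ s) has_real_derivative d) (at u within {q0'..q1})"
          using d f'[OF u, of s] by auto
      qed
      then have on: "q \<in> {q0..q1} \<and> p2 q = pcurve q \<and> \<Phi>2 q = ycurve q" if "q \<in> {q0'..q1}" for q
        using bd[OF that] that by (intro uniq) (simp add: sol_def)
      have "q0' \<in> {q0..q1}" "pcurve q0' = 0" using on[of q0'] lt e(3) by auto
      then have "q0' = q0"
        using level_pcurve[of q0'] unfolding q0_def q1[symmetric] by simp
      then show ?thesis using on by blast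
    qed
    have backward: "obtained_by_backward_solving lam h \<Gamma> x q0 pcurve ycurve"
      unfolding obtained_by_backward_solving_def q1_def[symmetric]
    proof (intro conjI allI ballI impI)
      show "backward_solution lam h \<Gamma> x q0 pcurve ycurve"
        unfolding backward_solution_def Let_def q1_def[symmetric]
      proof (intro conjI ballI)
        show "q0 < q1" "pcurve q1 = 1" "ycurve q1 = x" by (fact q01 ends)+
        fix q assume q: "q \<in> {q0..q1}"
        have "p' q * xi_species lam \<Gamma> s (ycurve q)
            + pcurve q * (\<Sum>t\<in>UNIV. partial_deriv t (xi_species lam \<Gamma> s) (ycurve q) * y' q $ t)
            = L_coeff lam h \<Gamma> x s * y' q $ s" for s
          unfolding L_ode[OF S_wide[OF q]] using ode[OF q, of s] by simp
        moreover have "(\<Sum>s\<in>UNIV. lam $ s * y' q $ s) = 1" using ly'[OF q] by (simp add: inner_lam)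
        ultimately show "\<exists>p' \<Phi>'.
           (pcurve has_real_derivative p') (at q within {q0..q1}) \<and>
           (ycurve has_vector_derivative \<Phi>') (at q within {q0..q1}) \<and>
           (\<forall>s. p' * xi_species lam \<Gamma> s (ycurve q)
                  + pcurve q * (\<Sum>s'\<in>UNIV. partial_deriv s' (xi_species lam \<Gamma> s) (ycurve q) * \<Phi>' $ s')
                = L_coeff lam h \<Gamma> x s * \<Phi>' $ s) \<and>
           (\<Sum>s\<in>UNIV. lam $ s * \<Phi>' $ s) = 1 \<and> 0 \<le> p' \<and> (\<forall>s. 0 \<le> \<Phi>' $ s)"
          using dp[OF q] dy[OF q] p'0[OF q] y'0[OF q]
          by (intro exI[of _ "p' q"] exI[of _ "y' q"]) (simp add: less_imp_le)
      qed
      show "pcurve q0 = 0" by (fact ends)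
      show "0 < pcurve q" if "q \<in> {q0<..q1}" for q
      proof -
        have "\<not> pcurve q \<le> pcurve q0"
          using that q01 pcurve_le_iff[of q q0] unfolding q0_def q1[symmetric] by auto
        then show ?thesis by (simp add: ends)
      qed
      fix a p2 \<Phi>2
      assume B: "backward_solution lam h \<Gamma> x a p2 \<Phi>2 \<and> (\<forall>q\<in>{a..q1}. 0 \<le> p2 q)"
      have "\<forall>q\<in>{a..q1}. \<exists>w. (p2 has_real_derivative fst w) (at q within {a..q1}) \<and>
           (\<Phi>2 has_vector_derivative snd w) (at q within {a..q1}) \<and>
           (\<forall>s. fst w * xi_species lam \<Gamma> s (\<Phi>2 q)
                  + p2 q * (\<Sum>s'\<in>UNIV. partial_deriv s' (xi_species lam \<Gamma> s) (\<Phi>2 q) * snd w $ s')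
                = L_coeff lam h \<Gamma> x s * snd w $ s) \<and>
           (\<Sum>s\<in>UNIV. lam $ s * snd w $ s) = 1 \<and> 0 \<le> fst w \<and> (\<forall>s. 0 \<le> snd w $ s)"
        using B unfolding backward_solution_def Let_def q1_def split_paired_Ex fst_conv snd_conv by blast
      then obtain w where w: "\<forall>q\<in>{a..q1}. (p2 has_real_derivative fst (w q)) (at q within {a..q1}) \<and>
           (\<Phi>2 has_vector_derivative snd (w q)) (at q within {a..q1}) \<and>
           (\<forall>s. fst (w q) * xi_species lam \<Gamma> s (\<Phi>2 q)
                  + p2 q * (\<Sum>s'\<in>UNIV. partial_deriv s' (xi_species lam \<Gamma> s) (\<Phi>2 q) * snd (w q) $ s')
                = L_coeff lam h \<Gamma> x s * snd (w q) $ s) \<and>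
           (\<Sum>s\<in>UNIV. lam $ s * snd (w q) $ s) = 1 \<and> 0 \<le> fst (w q) \<and> (\<forall>s. 0 \<le> snd (w q) $ s)"
        by (rule bchoice[elim_format]) blast
      have on: "q \<in> {q0..q1} \<and> p2 q = pcurve q \<and> \<Phi>2 q = ycurve q" if q: "q \<in> {a..q1}" for q
      proof (rule uniq, rule backward_solution_on_curve[of a p2 \<Phi>2 "\<lambda>q. fst (w q)" "\<lambda>q. snd (w q)", folded q1_def])
        show "a < q1" "p2 q1 = 1" "\<Phi>2 q1 = x"
          using B unfolding backward_solution_def Let_def q1_def by blast+
        show "0 \<le> p2 q" if "q \<in> {a..q1}" for q using B that by blast
        show "q \<in> {a..q1}" by (fact q)
        fix q assume q: "q \<in> {a..q1}"
        note wq = w[rule_format, OF q]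
        show "(p2 has_real_derivative fst (w q)) (at q within {a..q1})"
          "(\<Phi>2 has_vector_derivative snd (w q)) (at q within {a..q1})" "0 \<le> fst (w q)"
          using wq by blast+
        show "0 \<le> snd (w q) $ s" for s using wq by blast
        show "lam \<bullet> snd (w q) = 1" unfolding inner_lam using wq by blast
        show "fst (w q) * G s (\<Phi>2 q) + p2 q * (\<Sum>t\<in>UNIV. HH s t (\<Phi>2 q) * snd (w q) $ t) = Lam s * snd (w q) $ s"
          if "\<Phi>2 q \<in> wide_cube" for s
          using wq unfolding L_ode[OF that] by blast
        show "\<not> (p2 q = 0 \<and> fst (w q) = 0)"
        proof
          assume z: "p2 q = 0 \<and> fst (w q) = 0"
          have "snd (w q) $ s = 0" for s
          proof -
            have "fst (w q) * xi_species lam \<Gamma> s (\<Phi>2 q)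
                  + p2 q * (\<Sum>s'\<in>UNIV. partial_deriv s' (xi_species lam \<Gamma> s) (\<Phi>2 q) * snd (w q) $ s')
                = L_coeff lam h \<Gamma> x s * snd (w q) $ s" using wq by blast
            then show ?thesis using z Lam_pos[of s] lam_pos'[of s] by (simp add: L)
          qed
          then have "(\<Sum>s\<in>UNIV. lam $ s * snd (w q) $ s) = 0" by simp
          then show False using wq by simp
        qed
      qed
      have "a < q1" using B unfolding backward_solution_def Let_def q1_def by blast
      then show "q0 \<le> a" using on[of a] by simp
      show "p2 q = pcurve q" "\<Phi>2 q = ycurve q" if "q \<in> {a..q1}" for q using on[OF that] by auto
    qed
    show ?thesis
      unfolding q1_def[symmetric]
    proof (intro conjI exI[of _ q0] exI[of _ pcurve] exI[of _ ycurve])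
      show "0 < q1" using q0_pos q01 by (rule less_trans)
      show "\<forall>q0' p2 \<Phi>2. root_finding_trajectory lam h \<Gamma> x q0' p2 \<Phi>2 \<longrightarrow>
          q0' = q0 \<and> (\<forall>q\<in>{q0..q1}. p2 q = pcurve q \<and> \<Phi>2 q = ycurve q)"
        by (intro allI impI traj_unique)
      show "\<forall>s. 0 < ycurve q0 $ s \<longleftrightarrow> 0 < h $ s" using y_q0_pos by (rule allI)
    qed (fact traj backward mono_p conc q0_pos)+
  qed
  with h_iff show ?thesis by blast
qed

end
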